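(* Consider the semi-clairvoyant online algorithm U-CEQ which, at every time $t$ with $n_t$ active jobs, allocates $a_i(t)=\min\{h_i^k,P/n_t\}$ processors to each active job $J_i$ (where $J_i$ is currently in its phase $k$, with parallelism $h_i^k$) and runs all processors allocated to $J_i$ at the common speed $\left(\frac{1}{(\alpha-1)a_i(t)}\right)^{1/\alpha}$. Then U-CEQ is $O(1)$-competitive with respect to total flow time plus energy for any set of parallel jobs: there is a constant $C$ depending only on $\alpha$ (not on $P$) such that $G_{\text{U-CEQ}}(\mathcal{J})\le C\cdot G^*(\mathcal{J})$ for every $P$ and every job set $\mathcal{J}$.
   Context: Model: there are $P$ processors whose speeds can be set individually at every time; a processor running at speed $s\ge 0$ consumes power $s^\alpha$, where $\alpha>1$ is a fixed constant. A job set $\mathcal{J}=\{J_1,\dots,J_n\}$: each job $J_i$ has a release time $r_i\ge0$ and a sequence of phases $J_i^1,\dots,J_i^{k_i}$ executed in order; phase $J_i^k$ has work $w_i^k>0$ and parallelism $h_i^k\in[1,\infty]$. If at time $t$ job $J_i$ is in phase $k$ and is allocated $a_i(t)$ processors with speeds $s_1\ge\dots\ge s_{a_i(t)}$, its execution rate is $\sum_{j=1}^{\min\{a_i(t),h_i^k\}}s_j$. A valid schedule uses disjoint processor sets with $\sum_i a_i(t)\le P$, unallocated processors have speed $0$, no job runs before its release, phases run in order, and each job completes at finite time $c_i$. A job is active at $t$ if $r_i\le t\le c_i$; $n_t$ is the number of active jobs. $F(\mathcal{J})=\sum_i(c_i-r_i)$, $E(\mathcal{J})=\int_0^\infty u_t\,dt$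 with $u_t$ the total power at time $t$, $G=F+E$; $G_A$ is its value under algorithm $A$ and $G^*$ the minimum over all valid schedules. An algorithm is semi-clairvoyant if it knows the current (instantaneous) parallelism of each active job but no future information such as future parallelism or remaining work. As in the paper, $P/n_t$ is treated as an integer (rounded down otherwise).
   Formalization: The bound is stated for every P and job set on which U-CEQ completes all jobs: if n_t > P, rounding P/n_t down gives 0 processors and U-CEQ never finishes (e.g. P = 1, two jobs released at 0). That U-CEQ yields a valid schedule is proved whenever the number of jobs is at most P. *)

theory Defs
  imports "HOL-Analysis.Analysis"
begin

text \<open>A phase is a pair (work, parallelism).\<close>

record job =
  release :: real
  phases :: "(real \<times> ereal) list"

definition job_set :: "job list \<Rightarrow> bool" where
  "job_set J \<longleftrightarrow> (\<forall>j\<in>set J. 0 \<le> release j \<and> phases j \<noteq> [] \<and>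
     (\<forall>(w, h)\<in>set (phases j). 0 < w \<and> 1 \<le> h))"

text \<open>
  The processors are the naturals below \<open>P\<close>, the jobs of \<open>J\<close> are addressed by their list index,
  and \<open>owner S t p\<close> is the job to which processor \<open>p\<close> is allocated at time \<open>t\<close>. Hence
  different jobs always hold disjoint processor sets and the allocations sum to at most \<open>P\<close>.
\<close>

record schedule =
  owner :: "real \<Rightarrow> nat \<Rightarrow> nat option"
  speed :: "real \<Rightarrow> nat \<Rightarrow> real"

definition alloc :: "nat \<Rightarrow> schedule \<Rightarrow> nat \<Rightarrow> real \<Rightarrow> nat" where
  "alloc P S i t = card {p. p < P \<and> owner S t p = Some i}"

definition sorted_speeds :: "nat \<Rightarrow> schedule \<Rightarrow> nat \<Rightarrow> real \<Rightarrow> real list" where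
  "sorted_speeds P S i t =
     rev (sort (map (speed S t) (filter (\<lambda>p. owner S t p = Some i) [0..<P])))"

definition exec_rate :: "nat \<Rightarrow> schedule \<Rightarrow> nat \<Rightarrow> ereal \<Rightarrow> real \<Rightarrow> real" where
  "exec_rate P S i h t =
     (\<Sum>j | 1 \<le> j \<and> ereal (real j) \<le> min (ereal (real (alloc P S i t))) h.
        sorted_speeds P S i t ! (j - 1))"

text \<open>
  \<open>phase_end P J S i k\<close> is the time at which the first \<open>k\<close> phases of job \<open>i\<close> are finished
  (\<open>\<infinity>\<close> if this never happens): each phase starts when its predecessor ends and ends as soon
  as the execution rate has accumulated its work.
\<close>

primrec phase_end :: "nat \<Rightarrow> job list \<Rightarrow> schedule \<Rightarrow> nat \<Rightarrow> nat \<Rightarrow> ereal" where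
  "phase_end P J S i 0 = ereal (release (J ! i))"
| "phase_end P J S i (Suc k) =
     Inf {ereal t | t. phase_end P J S i k \<le> ereal t \<and>
        ennreal (fst (phases (J ! i) ! k)) \<le>
          (\<integral>\<^sup>+x\<in>{x. phase_end P J S i k \<le> ereal x \<and> x \<le> t}.
             ennreal (exec_rate P S i (snd (phases (J ! i) ! k)) x) \<partial>lborel)}"

definition completion :: "nat \<Rightarrow> job list \<Rightarrow> schedule \<Rightarrow> nat \<Rightarrow> ereal" where
  "completion P J S i = phase_end P J S i (length (phases (J ! i)))"

text \<open>Phases are counted from \<open>0\<close>.\<close>

definition in_phase :: "nat \<Rightarrow> job list \<Rightarrow> schedule \<Rightarrow> nat \<Rightarrow> nat \<Rightarrow> real \<Rightarrow> bool" where
  "in_phase P J S i k t \<longleftrightarrow> k < length (phases (J ! i)) \<and>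
     phase_end P J S i k \<le> ereal t \<and> ereal t < phase_end P J S i (Suc k)"

definition active :: "nat \<Rightarrow> job list \<Rightarrow> schedule \<Rightarrow> nat \<Rightarrow> real \<Rightarrow> bool" where
  "active P J S i t \<longleftrightarrow> release (J ! i) \<le> t \<and> ereal t \<le> completion P J S i"

definition num_active :: "nat \<Rightarrow> job list \<Rightarrow> schedule \<Rightarrow> real \<Rightarrow> nat" where
  "num_active P J S t = card {i. i < length J \<and> active P J S i t}"

definition valid_schedule :: "nat \<Rightarrow> job list \<Rightarrow> schedule \<Rightarrow> bool" where
  "valid_schedule P J S \<longleftrightarrow>
     (\<forall>p<P. (\<lambda>t. speed S t p) \<in> borel_measurable borel \<and>
        (\<forall>i. {t. owner S t p = Some i} \<in> sets borel)) \<and>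
     (\<forall>t. \<forall>p<P. 0 \<le> speed S t p \<and> (owner S t p = None \<longrightarrow> speed S t p = 0)) \<and>
     (\<forall>t. \<forall>p<P. \<forall>i. owner S t p = Some i \<longrightarrow> i < length J \<and> release (J ! i) \<le> t) \<and>
     (\<forall>i<length J. completion P J S i < \<infinity>)"

definition flow_time :: "nat \<Rightarrow> job list \<Rightarrow> schedule \<Rightarrow> ennreal" where
  "flow_time P J S =
     (\<Sum>i<length J. e2ennreal (completion P J S i - ereal (release (J ! i))))"

definition energy :: "real \<Rightarrow> nat \<Rightarrow> schedule \<Rightarrow> ennreal" where
  "energy \<alpha> P S = (\<integral>\<^sup>+t\<in>{0..}. ennreal (\<Sum>p<P. speed S t p powr \<alpha>) \<partial>lborel)"

definition cost :: "real \<Rightarrow> nat \<Rightarrow> job list \<Rightarrow> schedule \<Rightarrow> ennreal" where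
  "cost \<alpha> P J S = flow_time P J S + energy \<alpha> P S"

definition opt_cost :: "real \<Rightarrow> nat \<Rightarrow> job list \<Rightarrow> ennreal" where
  "opt_cost \<alpha> P J = (INF S\<in>{S. valid_schedule P J S}. cost \<alpha> P J S)"

text \<open>
  The allocation \<open>min {h, P / n\<^sub>t}\<close> is rounded down to a whole number of processors. If
  \<open>n\<^sub>t\<close> exceeds \<open>P\<close>, this is \<open>0\<close> and no active job makes progress; so in a schedule that
  completes all jobs this happens at most at isolated times, when releases and completions
  coincide. A job that is not in a phase is unreleased or has completed.
\<close>

definition uceq_schedule :: "real \<Rightarrow> nat \<Rightarrow> job list \<Rightarrow> schedule \<Rightarrow> bool" where
  "uceq_schedule \<alpha> P J S \<longleftrightarrow> valid_schedule P J S \<and>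
     (\<forall>t. \<forall>i<length J.
        (\<forall>k. in_phase P J S i k t \<longrightarrow>
           alloc P S i t =
             nat \<lfloor>real_of_ereal (min (snd (phases (J ! i) ! k))
                                    (ereal (real P / real (num_active P J S t))))\<rfloor> \<and>
           (\<forall>p<P. owner S t p = Some i \<longrightarrow>
              speed S t p = (1 / ((\<alpha> - 1) * real (alloc P S i t))) powr (1 / \<alpha>))) \<and>
        ((\<nexists>k. in_phase P J S i k t) \<longrightarrow> alloc P S i t = 0))"

end

theory Submission
  imports Defs
begin

text \<open>
  Under U-CEQ every running job uses power \<open>1 / (\<alpha> - 1)\<close>, so it suffices to bound the flow time,
  the integral of the number \<open>n\<close> of active jobs. Put \<open>\<beta> = 1 - 1/\<alpha>\<close> and compare with an arbitrary
  valid schedule. At almost every time an active job of U-CEQ (i) is active in the other schedule,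
  or (ii) is limited by its own parallelism, or (iii) runs on about \<open>P / n\<close> processors and has
  processed less of its current phase than the other schedule.

  Jobs of kind (ii) run at the energy-optimal rate for their parallelism, so their total time is
  bounded by the cost of the other schedule. For kind (iii), weight the progress of job \<open>i\<close> by
  \<open>rank\<^sup>\<beta>\<close>, where \<open>rank\<close> counts the active jobs released no later than \<open>i\<close>. This weight only
  decreases during the lifetime of the job, so while U-CEQ lags behind, its weighted progress is at
  most that of the other schedule. The former is of order \<open>n\<close> unless most jobs are of kind (i)
  or (ii); the latter is at most \<open>n\<^sup>\<beta>\<close> times the total speed, which by Young's inequality is
  absorbed into a fraction of \<open>n\<close> and a multiple of the power.

  For existence, U-CEQ depends on its own future only through the completion times. They are found
  in increasing order: the next completion is not influenced by the later ones.
\<close>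

section \<open>Cumulative integrals\<close>

text \<open>The exponent \<beta> comes from the speed rule: \<open>a\<close> processors at the
  prescribed speed give rate \<kappa> a^\<beta>. So rank^\<beta> times the rate on about P / n
  processors is, up to a constant and P^\<beta>, equal to (rank / n)^\<beta>, which is at least rank
  / n. The same \<beta> is the exponent with which Young's inequality trades n^\<beta> s against n
  and s^\<alpha>. The obstacle is that two schedules may process the same phase at quite different
  times, so only integrals of progress can be exchanged, and only under weights that do not grow
  while the job lives. The number n itself is no such weight, since arrivals raise it. Phases
  limited by parallelism are not matched in time: with H the whole part of the parallelism, work /
  H^\<beta> depends on the job set alone. U-CEQ consumes it at rate \<kappa> per limited job, and
  every schedule has to pay for all of it. Rounding P / n down costs a factor 2 only while at most P
  jobs run; this is deduced from the completion of all jobs. Jobs still count as active at the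
  instant of completion, so the clean counts hold only almost everywhere.\<close>

lemma nn_integral_sublevel_le:
  fixes f :: "real \<Rightarrow> ennreal"
  assumes [measurable]: "f \<in> borel_measurable borel"
  shows "(\<integral>\<^sup>+x\<in>{t. (\<integral>\<^sup>+y\<in>{..t}. f y \<partial>lborel) < v}. f x \<partial>lborel) \<le> v"
proof -
  define \<mu> where "\<mu> = density lborel f"
  have sets_\<mu> [measurable_cong]: "sets \<mu> = sets borel" by (simp add: \<mu>_def)
  have em: "emeasure \<mu> A = (\<integral>\<^sup>+x\<in>A. f x \<partial>lborel)" if "A \<in> sets borel" for A
    using that by (simp add: \<mu>_def emeasure_density)
  define S where "S = {t. emeasure \<mu> {..t} < v}"
  have down: "y \<in> S" if "x \<in> S" "y \<le> x" for x y
  proof -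
    have "emeasure \<mu> {..y} \<le> emeasure \<mu> {..x}" using that by (intro emeasure_mono) auto
    thus ?thesis using that by (auto simp: S_def)
  qed
  \<comment> \<open>\<open>S\<close> is an initial segment of the line. Half-lines with endpoints
    inside \<open>S\<close> have mass below \<open>v\<close>, so exhausting \<open>S\<close> by them
    and using continuity from below gives mass at most \<open>v\<close>, even if the cumulative mass
    becomes infinite right after \<open>S\<close>. Without a greatest element, the rationals in
    \<open>S\<close> are cofinal, and the running maxima of an enumeration form the
    sequence.\<close>
  have "\<exists>s::nat \<Rightarrow> real. incseq s \<and> range s \<subseteq> S \<and> S = (\<Union>n. {..s n})" if ne: "S \<noteq> {}"
  proof (cases "\<exists>m\<in>S. \<forall>x\<in>S. x \<le> m")
    case True
    then obtain m where "m \<in> S" "\<forall>x\<in>S. x \<le> m" by blast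
    hence "S = {..m}" using down by auto
    thus ?thesis using \<open>m \<in> S\<close> by (intro exI[of _ "\<lambda>_. m"]) (auto simp: incseq_def)
  next
    case False
    define A where "A = S \<inter> \<rat>"
    have cofinal: "\<exists>q\<in>A. x \<le> q" if x: "x \<in> S" for x
    proof -
      obtain y where y: "y \<in> S" "x < y" using False x by force
      obtain q where "q \<in> \<rat>" "x < q" "q < y" using Rats_dense_in_real[OF y(2)] by blast
      thus ?thesis using down[OF y(1), of q] unfolding A_def by (intro bexI[of _ q]) auto
    qed
    have "A \<noteq> {}" using ne cofinal by blast
    moreover have "countable A" unfolding A_def by (rule countable_subset[OF _ countable_rat]) auto
    ultimately have e: "range (from_nat_into A) = A" by (rule range_from_nat_into)
    define s where "s n = Max (from_nat_into A ` {..n})" for n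
    have s_mem: "s n \<in> A" for n
    proof -
      have "s n \<in> from_nat_into A ` {..n}" unfolding s_def by (intro Max_in) auto
      thus ?thesis using e by auto
    qed
    have "incseq s" unfolding incseq_def s_def by (auto intro!: Max_mono)
    moreover have "range s \<subseteq> S" using s_mem by (auto simp: A_def)
    moreover have "S = (\<Union>n. {..s n})"
    proof (intro equalityI subsetI)
      fix x assume "x \<in> S"
      then obtain q where q: "q \<in> A" "x \<le> q" using cofinal by blast
      then obtain n where "q = from_nat_into A n" using e by (metis imageE)
      hence "q \<le> s n" unfolding s_def by (intro Max_ge) auto
      thus "x \<in> (\<Union>n. {..s n})" using q by (intro UN_I[of n]) auto
    next
      fix x assume "x \<in> (\<Union>n. {..s n})"
      thus "x \<in> S" using s_mem down by (force simp: A_def)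
    qed
    ultimately show ?thesis by blast
  qed
  then consider "S = {}" | s where "incseq s" "range s \<subseteq> S" "S = (\<Union>n::nat. {..s n})" by blast
  hence "emeasure \<mu> S \<le> v \<and> S \<in> sets borel"
  proof cases
    case 2
    have "emeasure \<mu> S = (SUP n. emeasure \<mu> {..s n})"
      unfolding 2(3) using 2(1)
      by (intro SUP_emeasure_incseq[symmetric]) (auto simp: sets_\<mu> mono_def intro: order_trans)
    also have "\<dots> \<le> v" using 2(2) by (intro SUP_least less_imp_le) (auto simp: S_def)
    finally show ?thesis using 2 by auto
  qed auto
  moreover have "S = {t. (\<integral>\<^sup>+y\<in>{..t}. f y \<partial>lborel) < v}" by (simp add: S_def em)
  ultimately show ?thesis using em[of S] by metis
qed

text \<open>Where \<open>f\<close> lags behind \<open>g\<close> inside \<open>D\<close>, its cumulative integral is below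
  \<open>v = \<integral>\<^sub>D g\<close>, and \<open>f\<close> has mass at most \<open>v\<close> on that sublevel set.\<close>

lemma lag_integral_le:
  fixes f g :: "real \<Rightarrow> ennreal"
  assumes [measurable]: "f \<in> borel_measurable borel"
    and D: "\<And>x y. x \<in> D \<Longrightarrow> y \<le> x \<Longrightarrow> g y \<noteq> 0 \<Longrightarrow> y \<in> D"
  shows "(\<integral>\<^sup>+x\<in>{x\<in>D. (\<integral>\<^sup>+y\<in>{..x}. f y \<partial>lborel) < (\<integral>\<^sup>+y\<in>{..x}. g y \<partial>lborel)}. f x \<partial>lborel)
    \<le> (\<integral>\<^sup>+x\<in>D. g x \<partial>lborel)"
proof -
  let ?v = "\<integral>\<^sup>+x\<in>D. g x \<partial>lborel"
  have "(\<integral>\<^sup>+y\<in>{..x}. g y \<partial>lborel) \<le> ?v" if "x \<in> D" for x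
    using D[OF that] by (intro nn_integral_mono) (auto simp: indicator_def)
  hence "(\<integral>\<^sup>+x\<in>{x\<in>D. (\<integral>\<^sup>+y\<in>{..x}. f y \<partial>lborel) < (\<integral>\<^sup>+y\<in>{..x}. g y \<partial>lborel)}. f x \<partial>lborel)
     \<le> (\<integral>\<^sup>+x\<in>{x. (\<integral>\<^sup>+y\<in>{..x}. f y \<partial>lborel) < ?v}. f x \<partial>lborel)"
    by (intro nn_integral_mono mult_left_mono) (fastforce simp: indicator_def)+
  also have "\<dots> \<le> ?v" by (rule nn_integral_sublevel_le) fact
  finally show ?thesis .
qed

lemma borel_measurable_cumulative [measurable]:
  fixes f :: "real \<Rightarrow> ennreal"
  assumes [measurable]: "f \<in> borel_measurable borel"
  shows "(\<lambda>t. \<integral>\<^sup>+y\<in>{..t}. f y \<partial>lborel) \<in> borel_measurable borel"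
proof -
  have "(\<lambda>t. \<integral>\<^sup>+y. f y * indicator {p. snd p \<le> fst p} (t, y) \<partial>lborel) \<in> borel_measurable borel"
    by measurable
  thus ?thesis by (simp add: indicator_def)
qed

text \<open>Layer-cake argument: the weight is a nonnegative combination of the indicators of
  \<open>D m\<close>, the times after \<open>r\<close> with \<rho> above \<open>m\<close>. As \<rho>
  is decreasing after \<open>r\<close>, each \<open>D m\<close> is an initial segment of the
  half-line from \<open>r\<close>, so the unweighted exchange applies to every layer.\<close>

lemma weighted_lag_integral_le:
  fixes f g :: "real \<Rightarrow> ennreal" and \<rho> :: "real \<Rightarrow> nat" and \<phi> :: "nat \<Rightarrow> real"
  assumes [measurable]: "f \<in> borel_measurable borel" "g \<in> borel_measurable borel"
      "\<rho> \<in> measurable borel (count_space UNIV)"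
    and f0: "\<And>x. x < r \<Longrightarrow> f x = 0" and g0: "\<And>x. x < r \<Longrightarrow> g x = 0"
    and anti: "\<And>x y. r \<le> x \<Longrightarrow> x \<le> y \<Longrightarrow> \<rho> y \<le> \<rho> x"
    and le_N: "\<And>x. \<rho> x \<le> N" and "\<phi> 0 = 0" "mono \<phi>"
  shows "(\<integral>\<^sup>+x\<in>{x. (\<integral>\<^sup>+y\<in>{..x}. f y \<partial>lborel) < (\<integral>\<^sup>+y\<in>{..x}. g y \<partial>lborel)}.
      ennreal (\<phi> (\<rho> x)) * f x \<partial>lborel)
    \<le> (\<integral>\<^sup>+x. ennreal (\<phi> (\<rho> x)) * g x \<partial>lborel)"
proof -
  let ?lag = "{x. (\<integral>\<^sup>+y\<in>{..x}. f y \<partial>lborel) < (\<integral>\<^sup>+y\<in>{..x}. g y \<partial>lborel)}"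
  have [measurable]: "?lag \<in> sets borel" by measurable
  define D where "D m = {x. r \<le> x \<and> m < \<rho> x}" for m
  have [measurable]: "D m \<in> sets borel" for m unfolding D_def by measurable
  define d where "d m = ennreal (\<phi> (Suc m) - \<phi> m)" for m
  have layer: "ennreal (\<phi> (\<rho> x)) = (\<Sum>m<N. d m * indicator (D m) x)" if "r \<le> x" for x
  proof -
    have tele: "(\<Sum>m<k. \<phi> (Suc m) - \<phi> m) = \<phi> k" for k
      using \<open>\<phi> 0 = 0\<close> by (induction k) auto
    have "(\<Sum>m<N. d m * indicator (D m) x) = (\<Sum>m<\<rho> x. d m)"
      using that le_N[of x] by (intro sum.mono_neutral_cong_right) (auto simp: D_def)
    also have "\<dots> = ennreal (\<Sum>m<\<rho> x. \<phi> (Suc m) - \<phi> m)"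
      unfolding d_def using \<open>mono \<phi>\<close> by (intro sum_ennreal) (auto simp: mono_def)
    finally show ?thesis by (simp add: tele)
  qed
  have expand: "(\<integral>\<^sup>+x. ennreal (\<phi> (\<rho> x)) * h x \<partial>lborel) = (\<Sum>m<N. d m * (\<integral>\<^sup>+x\<in>D m. h x \<partial>lborel))"
    if [measurable]: "h \<in> borel_measurable borel" and h0: "\<And>x. x < r \<Longrightarrow> h x = 0" for h
  proof -
    have "(\<integral>\<^sup>+x. ennreal (\<phi> (\<rho> x)) * h x \<partial>lborel)
        = (\<integral>\<^sup>+x. (\<Sum>m<N. d m * (h x * indicator (D m) x)) \<partial>lborel)"
    proof (intro nn_integral_cong)
      fix x
      show "ennreal (\<phi> (\<rho> x)) * h x = (\<Sum>m<N. d m * (h x * indicator (D m) x))"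
      proof (cases "r \<le> x")
        case True
        show ?thesis unfolding layer[OF True] sum_distrib_right by (intro sum.cong) (simp_all add: mult_ac)
      qed (simp add: h0)
    qed
    also have "\<dots> = (\<Sum>m<N. d m * (\<integral>\<^sup>+x\<in>D m. h x \<partial>lborel))"
      by (simp add: nn_integral_sum nn_integral_cmult)
    finally show ?thesis .
  qed
  have "(\<integral>\<^sup>+x\<in>?lag. ennreal (\<phi> (\<rho> x)) * f x \<partial>lborel)
      = (\<integral>\<^sup>+x. ennreal (\<phi> (\<rho> x)) * (f x * indicator ?lag x) \<partial>lborel)"
    by (simp add: mult_ac)
  also have "\<dots> = (\<Sum>m<N. d m * (\<integral>\<^sup>+x\<in>D m. (f x * indicator ?lag x) \<partial>lborel))"
    by (rule expand) (simp_all add: f0)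
  also have "\<dots> \<le> (\<Sum>m<N. d m * (\<integral>\<^sup>+x\<in>D m. g x \<partial>lborel))"
  proof (intro sum_mono mult_left_mono)
    fix m
    have "(\<integral>\<^sup>+x\<in>D m. (f x * indicator ?lag x) \<partial>lborel) = (\<integral>\<^sup>+x\<in>{x\<in>D m. x \<in> ?lag}. f x \<partial>lborel)"
      by (intro nn_integral_cong) (auto split: split_indicator)
    also have "\<dots> \<le> (\<integral>\<^sup>+x\<in>D m. g x \<partial>lborel)"
      unfolding mem_Collect_eq
    proof (rule lag_integral_le)
      fix x y assume "x \<in> D m" "y \<le> x" "g y \<noteq> 0"
      thus "y \<in> D m" using g0[of y] anti[of y x] by (force simp: D_def)
    qed fact
    finally show "(\<integral>\<^sup>+x\<in>D m. (f x * indicator ?lag x) \<partial>lborel) \<le> (\<integral>\<^sup>+x\<in>D m. g x \<partial>lborel)" .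
  qed auto
  also have "\<dots> = (\<integral>\<^sup>+x. ennreal (\<phi> (\<rho> x)) * g x \<partial>lborel)"
    by (rule expand[symmetric]) (simp_all add: g0)
  finally show ?thesis .
qed

text \<open>Young's inequality with conjugate exponents 1/\<beta> and \<alpha>, without sharp
  constants. Either the first term on the right already dominates, or \<epsilon> x^(1/\<alpha>) < s;
  in the latter case x^\<beta> is the (\<alpha> - 1)-th power of x^(1/\<alpha>), and bounding that
  base by s / \<epsilon> leaves the second term.\<close>

lemma young_powr:
  fixes x s \<epsilon> \<alpha> :: real
  assumes "1 < \<alpha>" "0 < \<epsilon>" "0 \<le> x" "0 \<le> s"
  shows "x powr (1 - 1/\<alpha>) * s \<le> \<epsilon> * x + \<epsilon> powr (1 - \<alpha>) * s powr \<alpha>"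
proof (cases "x = 0 \<or> x powr (1 - 1/\<alpha>) * s \<le> \<epsilon> * x")
  case True
  hence "x powr (1 - 1/\<alpha>) * s \<le> \<epsilon> * x" by auto
  also have "\<dots> \<le> \<epsilon> * x + \<epsilon> powr (1 - \<alpha>) * s powr \<alpha>" by simp
  finally show ?thesis .
next
  case False
  with assms have x: "0 < x" by auto
  have "x = x powr (1 - 1/\<alpha>) * x powr (1/\<alpha>)" using x by (simp flip: powr_add)
  with False have "x powr (1 - 1/\<alpha>) * (\<epsilon> * x powr (1/\<alpha>)) < x powr (1 - 1/\<alpha>) * s"
    by (metis not_le mult.left_commute)
  hence lt: "\<epsilon> * x powr (1/\<alpha>) < s" using x by simp
  hence s: "0 < s" using x assms by (smt (verit) mult_pos_pos powr_gt_zero)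
  have "x powr (1/\<alpha>) \<le> s / \<epsilon>" using lt assms by (simp add: field_simps)
  hence "(x powr (1/\<alpha>)) powr (\<alpha> - 1) \<le> (s / \<epsilon>) powr (\<alpha> - 1)" using assms by (intro powr_mono2) auto
  moreover have "(x powr (1/\<alpha>)) powr (\<alpha> - 1) = x powr (1 - 1/\<alpha>)"
    using assms by (simp add: powr_powr field_simps)
  moreover have "(s / \<epsilon>) powr (\<alpha> - 1) * s = \<epsilon> powr (1 - \<alpha>) * s powr \<alpha>"
  proof -
    have "(s / \<epsilon>) powr (\<alpha> - 1) * s = \<epsilon> powr (- (\<alpha> - 1)) * (s powr (\<alpha> - 1) * s powr 1)"
      using assms s unfolding powr_minus by (simp add: powr_divide field_simps)
    also have "s powr (\<alpha> - 1) * s powr 1 = s powr \<alpha>" by (simp only: powr_add[symmetric]) simp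
    finally show ?thesis by simp
  qed
  ultimately have "x powr (1 - 1/\<alpha>) * s \<le> \<epsilon> powr (1 - \<alpha>) * s powr \<alpha>"
    by (metis assms(4) mult_right_mono)
  also have "\<dots> \<le> \<epsilon> * x + \<epsilon> powr (1 - \<alpha>) * s powr \<alpha>" using assms by simp
  finally show ?thesis .
qed

section \<open>Execution rates and hitting times\<close>

text \<open>The rounding expression of \<open>uceq_schedule\<close>. As the second argument is real,
  for nonnegative \<open>h\<close> the minimum is finite even at infinite parallelism, so
  \<open>real_of_ereal\<close> loses nothing.\<close>

definition whole :: "ereal \<Rightarrow> real \<Rightarrow> nat" where
  "whole h x = nat \<lfloor>real_of_ereal (min h (ereal x))\<rfloor>"

lemma le_whole_iff:
  assumes "0 \<le> h" "0 \<le> x"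
  shows "j \<le> whole h x \<longleftrightarrow> ereal (real j) \<le> h \<and> real j \<le> x"
proof -
  define y where "y = real_of_ereal (min h (ereal x))"
  have y: "min h (ereal x) = ereal y" "0 \<le> y"
    using assms by (cases h; auto simp: min_def y_def)+
  have "j \<le> whole h x \<longleftrightarrow> ereal (real j) \<le> min h (ereal x)"
    using y by (simp add: whole_def le_nat_iff le_floor_iff)
  thus ?thesis by simp
qed

lemma whole_le: "0 \<le> h \<Longrightarrow> 0 \<le> x \<Longrightarrow> real (whole h x) \<le> x"
  and whole_le_parallelism: "0 \<le> h \<Longrightarrow> 0 \<le> x \<Longrightarrow> ereal (real (whole h x)) \<le> h"
  using le_whole_iff[of h x "whole h x"] by auto

text \<open>Exchange argument: after cancelling the common elements, \<open>B\<close> has no more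
  left than the top \<open>m\<close> elements \<open>T\<close>. The largest remaining value \<theta>
  of \<open>B\<close> lies below every remaining value of \<open>T\<close>, and \<theta> \<ge> 0
  makes the surplus elements of \<open>T\<close> harmless.\<close>

lemma sum_top_ge:
  fixes v :: "'a \<Rightarrow> real"
  assumes "sorted_wrt (\<lambda>p q. v q \<le> v p) ps" "distinct ps"
    and "B \<subseteq> set ps" "card B \<le> m" and nonneg: "\<And>p. p \<in> set ps \<Longrightarrow> 0 \<le> v p"
  shows "sum v B \<le> sum v (set (take m ps))"
proof -
  define T where "T = set (take m ps)"
  have TS: "T \<subseteq> set ps" unfolding T_def by (rule set_take_subset)
  have fin: "finite B" "finite T" using assms by (auto simp: T_def intro: finite_subset)
  show ?thesis
  proof (cases "length ps \<le> m")
    case True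
    thus ?thesis using assms by (auto intro!: sum_mono2)
  next
    case False
    hence cT: "card T = m" using assms(2) by (simp add: T_def distinct_card)
    have cross: "v q \<le> v p" if "p \<in> T" "q \<in> B - T" for p q
    proof -
      have "q \<in> set (drop m ps)"
        using that assms(3) append_take_drop_id[of m ps] unfolding T_def by (metis DiffE UnE set_append subsetD)
      thus ?thesis using assms(1) that append_take_drop_id[of m ps] unfolding T_def
        by (metis sorted_wrt_append)
    qed
    have "card B = card (B \<inter> T) + card (B - T)" "card T = card (T \<inter> B) + card (T - B)"
      using fin by (auto intro: card_Int_Diff)
    hence cards: "card (B - T) \<le> card (T - B)" using assms(4) cT by (simp add: Int_commute)
    have "sum v (B - T) \<le> sum v (T - B)"
    proof (cases "B - T = {}")
      case True
      hence "sum v (B - T) = 0" by (simp only: sum.empty)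
      thus ?thesis using nonneg TS by (auto intro!: sum_nonneg)
    next
      case False
      define \<theta> where "\<theta> = Max (v ` (B - T))"
      have "\<theta> \<in> v ` (B - T)" unfolding \<theta>_def using False fin by (intro Max_in) auto
      then obtain q where q: "q \<in> B - T" "\<theta> = v q" by blast
      hence "0 \<le> \<theta>" using nonneg assms(3) by auto
      have "sum v (B - T) \<le> real (card (B - T)) * \<theta>"
        unfolding \<theta>_def using fin by (intro sum_bounded_above) auto
      also have "\<dots> \<le> real (card (T - B)) * \<theta>" using cards \<open>0 \<le> \<theta>\<close> by (intro mult_right_mono) auto
      also have "\<dots> \<le> sum v (T - B)" using cross q by (intro sum_bounded_below) auto
      finally show ?thesis .
    qed
    moreover have "sum v B = sum v (B \<inter> T) + sum v (B - T)" "sum v T = sum v (T \<inter> B) + sum v (T - B)"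
      using fin by (auto intro: sum.Int_Diff)
    ultimately show ?thesis unfolding T_def by (simp add: Int_commute)
  qed
qed

definition speed_for :: "schedule \<Rightarrow> nat \<Rightarrow> nat \<Rightarrow> real \<Rightarrow> real" where
  "speed_for S i p t = speed S t p * indicator {x. owner S x p = Some i} t"

text \<open>Replaces the sorted list by a maximum over a finite family of processor sets that is the
  same at all times. This yields measurability of the rate in \<open>t\<close>, and
  \<open>exec_rate_attained\<close> reads estimates off a maximizing set.\<close>

lemma exec_rate_eq_Max:
  assumes h: "0 \<le> h" and nonneg: "\<And>p. p < P \<Longrightarrow> 0 \<le> speed S t p"
  shows "exec_rate P S i h t =
    Max ((\<lambda>B. \<Sum>p\<in>B. speed_for S i p t) ` {B. B \<subseteq> {..<P} \<and> ereal (real (card B)) \<le> h})"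
proof -
  define own where "own = filter (\<lambda>p. owner S t p = Some i) [0..<P]"
  define ps where "ps = rev (sort_key (speed S t) own)"
  have set_ps: "set ps = {p. p < P \<and> owner S t p = Some i}" and dist: "distinct ps"
    by (auto simp: ps_def own_def)
  have speeds: "sorted_speeds P S i t = map (speed S t) ps"
  proof -
    have "sort (map (speed S t) own) = map (speed S t) (sort_key (speed S t) own)"
      by (rule properties_for_sort) (simp_all add: mset_map)
    thus ?thesis by (simp add: sorted_speeds_def ps_def own_def rev_map)
  qed
  have desc: "sorted_wrt (\<lambda>p q. speed S t q \<le> speed S t p) ps"
  proof -
    have "sorted (map (speed S t) (sort_key (speed S t) own))" by simp
    thus ?thesis by (simp add: ps_def sorted_wrt_rev sorted_wrt_map)
  qed
  have len: "alloc P S i t = length ps"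
    unfolding alloc_def set_ps[symmetric] using dist by (rule distinct_card)
  define m where "m = whole h (real (length ps))"
  have m_le: "m \<le> length ps" and m_h: "ereal (real m) \<le> h"
    using h whole_le[of h "real (length ps)"] whole_le_parallelism[of h "real (length ps)"]
    by (auto simp: m_def)
  have "{j. 1 \<le> j \<and> ereal (real j) \<le> min (ereal (real (alloc P S i t))) h} = {1..m}"
    unfolding len m_def using h by (auto simp: le_whole_iff)
  hence "exec_rate P S i h t = (\<Sum>j = 1..m. map (speed S t) ps ! (j - 1))"
    unfolding exec_rate_def speeds by simp
  also have "\<dots> = (\<Sum>j<m. map (speed S t) ps ! j)"
    by (rule sum.reindex_bij_witness[of _ Suc "\<lambda>j. j - 1"]) auto
  also have "\<dots> = sum_list (map (speed S t) (take m ps))"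
    using m_le by (simp add: sum_list_sum_nth atLeast0LessThan)
  also have "\<dots> = sum (speed S t) (set (take m ps))"
    using dist by (intro sum_list_distinct_conv_sum_set) auto
  finally have rate: "exec_rate P S i h t = sum (speed S t) (set (take m ps))" .
  have sub: "set (take m ps) \<subseteq> set ps" by (rule set_take_subset)
  have rate': "exec_rate P S i h t = (\<Sum>p\<in>set (take m ps). speed_for S i p t)"
    unfolding rate using sub set_ps by (intro sum.cong) (auto simp: speed_for_def)
  show ?thesis
  proof (rule Max_eqI[symmetric])
    show "finite ((\<lambda>B. \<Sum>p\<in>B. speed_for S i p t) ` {B. B \<subseteq> {..<P} \<and> ereal (real (card B)) \<le> h})"
      by (rule finite_imageI, rule finite_subset[of _ "Pow {..<P}"]) auto
  next
    have "card (set (take m ps)) = m" using m_le dist by (simp add: distinct_card)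
    thus "exec_rate P S i h t \<in> (\<lambda>B. \<Sum>p\<in>B. speed_for S i p t) ` {B. B \<subseteq> {..<P} \<and> ereal (real (card B)) \<le> h}"
      unfolding rate' using m_h sub set_ps by (intro imageI) auto
  next
    fix y assume "y \<in> (\<lambda>B. \<Sum>p\<in>B. speed_for S i p t) ` {B. B \<subseteq> {..<P} \<and> ereal (real (card B)) \<le> h}"
    then obtain B where B: "B \<subseteq> {..<P}" "ereal (real (card B)) \<le> h" "y = (\<Sum>p\<in>B. speed_for S i p t)" by blast
    have "finite B" using B by (auto intro: finite_subset)
    have "card (B \<inter> set ps) \<le> card B" "card (B \<inter> set ps) \<le> length ps"
      using \<open>finite B\<close> dist by (auto intro!: card_mono simp flip: distinct_card)
    hence "card (B \<inter> set ps) \<le> m"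
      using h unfolding m_def by (subst le_whole_iff) (auto intro: order_trans[OF _ B(2)])
    hence "sum (speed S t) (B \<inter> set ps) \<le> sum (speed S t) (set (take m ps))"
      using desc dist set_ps nonneg by (intro sum_top_ge) auto
    moreover have "y = sum (speed S t) (B \<inter> set ps)"
      unfolding B(3) using \<open>finite B\<close> B(1) set_ps
      by (intro sum.mono_neutral_cong_right) (auto simp: speed_for_def indicator_def)
    ultimately show "y \<le> exec_rate P S i h t" using rate by simp
  qed
qed

lemma exec_rate_attained:
  assumes "0 \<le> h" and "\<And>p. p < P \<Longrightarrow> 0 \<le> speed S t p"
  shows "\<exists>B\<subseteq>{..<P}. ereal (real (card B)) \<le> h \<and> exec_rate P S i h t = (\<Sum>p\<in>B. speed_for S i p t)"
proof -
  let ?F = "{B. B \<subseteq> {..<P} \<and> ereal (real (card B)) \<le> h}"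
  have "finite ?F" by (rule finite_subset[of _ "Pow {..<P}"]) auto
  moreover have "{} \<in> ?F" using assms(1) by (simp flip: zero_ereal_def)
  moreover have "exec_rate P S i h t = Max ((\<lambda>B. \<Sum>p\<in>B. speed_for S i p t) ` ?F)"
    using assms by (rule exec_rate_eq_Max)
  ultimately have "exec_rate P S i h t \<in> (\<lambda>B. \<Sum>p\<in>B. speed_for S i p t) ` ?F"
    by (metis (no_types, lifting) Max_in empty_iff finite_imageI image_is_empty)
  thus ?thesis by auto
qed

lemma exec_rate_const_speed:
  assumes "ereal (real (alloc P S i t)) \<le> h"
    and "\<And>p. p < P \<Longrightarrow> owner S t p = Some i \<Longrightarrow> speed S t p = \<sigma>"
  shows "exec_rate P S i h t = real (alloc P S i t) * \<sigma>"
proof -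
  let ?ys = "sorted_speeds P S i t"
  have "set (filter (\<lambda>p. owner S t p = Some i) [0..<P]) = {p. p < P \<and> owner S t p = Some i}"
    by auto
  hence len: "length ?ys = alloc P S i t"
    unfolding sorted_speeds_def alloc_def by (simp flip: distinct_card)
  have nth: "?ys ! j = \<sigma>" if "j < alloc P S i t" for j
  proof -
    have "?ys ! j \<in> set ?ys" using that len by simp
    moreover have "set ?ys \<subseteq> {\<sigma>}" using assms(2) by (auto simp: sorted_speeds_def)
    ultimately show ?thesis by blast
  qed
  have "{j. 1 \<le> j \<and> ereal (real j) \<le> min (ereal (real (alloc P S i t))) h} = {1..alloc P S i t}"
    by (auto intro: order_trans[OF _ assms(1)])
  hence "exec_rate P S i h t = (\<Sum>j = 1..alloc P S i t. ?ys ! (j - 1))"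
    unfolding exec_rate_def by simp
  also have "\<dots> = (\<Sum>j = 1..alloc P S i t. \<sigma>)" by (intro sum.cong) (auto simp: nth)
  finally show ?thesis by simp
qed

text \<open>One step of the recursion for \<open>phase_end\<close>, with the rate as a free
  argument. Thus the same facts serve actual schedules and the simulated runs of the existence
  proof.\<close>

definition hit_time :: "ereal \<Rightarrow> real \<Rightarrow> (real \<Rightarrow> real) \<Rightarrow> ereal" where
  "hit_time a w f = Inf {ereal t | t. a \<le> ereal t \<and>
     ennreal w \<le> (\<integral>\<^sup>+x\<in>{x. a \<le> ereal x \<and> x \<le> t}. ennreal (f x) \<partial>lborel)}"

lemma phase_end_Suc:
  "phase_end P J S i (Suc k) = hit_time (phase_end P J S i k) (fst (phases (J ! i) ! k))
     (exec_rate P S i (snd (phases (J ! i) ! k)))"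
  by (simp add: hit_time_def)

lemma hit_time_ge: "a \<le> hit_time a w f"
  unfolding hit_time_def by (rule Inf_greatest) auto

lemma hit_time_le:
  assumes "r \<le> t" "ennreal w \<le> (\<integral>\<^sup>+x\<in>{r..t}. ennreal (f x) \<partial>lborel)"
  shows "hit_time (ereal r) w f \<le> ereal t"
proof -
  have "{x. r \<le> x \<and> x \<le> t} = {r..t}" by auto
  thus ?thesis unfolding hit_time_def using assms by (intro Inf_lower) auto
qed

lemma hit_time_lessD:
  assumes "hit_time (ereal r) w f < ereal t"
  shows "r \<le> t" "ennreal w \<le> (\<integral>\<^sup>+x\<in>{r..t}. ennreal (f x) \<partial>lborel)"
proof -
  obtain s where s: "s < t" "r \<le> s" "ennreal w \<le> (\<integral>\<^sup>+x\<in>{x. r \<le> x \<and> x \<le> s}. ennreal (f x) \<partial>lborel)"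
    using assms unfolding hit_time_def Inf_less_iff by auto
  show "r \<le> t" using s by simp
  note s(3)
  also have "(\<integral>\<^sup>+x\<in>{x. r \<le> x \<and> x \<le> s}. ennreal (f x) \<partial>lborel) \<le> (\<integral>\<^sup>+x\<in>{r..t}. ennreal (f x) \<partial>lborel)"
    using s(1) by (intro nn_integral_mono) (auto simp: indicator_def)
  finally show "ennreal w \<le> (\<integral>\<^sup>+x\<in>{r..t}. ennreal (f x) \<partial>lborel)" .
qed

text \<open>The intervals \<open>{r..\<tau> + inverse (real (Suc n))}\<close> shrink to
  \<open>{r..\<tau>}\<close>, and the measure with density \<open>f\<close> is continuous from above
  along them because it is finite on bounded intervals.\<close>

lemma hit_time_attained:
  assumes [measurable]: "f \<in> borel_measurable borel"
    and fin: "\<And>b. (\<integral>\<^sup>+x\<in>{r..b}. ennreal (f x) \<partial>lborel) < \<infinity>"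
    and \<tau>: "hit_time (ereal r) w f = ereal \<tau>"
  shows "ennreal w \<le> (\<integral>\<^sup>+x\<in>{r..\<tau>}. ennreal (f x) \<partial>lborel)"
proof -
  define \<mu> where "\<mu> = density lborel (\<lambda>x. ennreal (f x))"
  have em: "emeasure \<mu> {r..b} = (\<integral>\<^sup>+x\<in>{r..b}. ennreal (f x) \<partial>lborel)" for b
    by (simp add: \<mu>_def emeasure_density)
  let ?A = "\<lambda>n. {r..\<tau> + inverse (real (Suc n))}"
  have "ennreal w \<le> emeasure \<mu> (?A n)" for n
    unfolding em by (rule hit_time_lessD) (simp add: \<tau>)
  hence "ennreal w \<le> (INF n. emeasure \<mu> (?A n))" by (rule INF_greatest)
  also have "\<dots> = emeasure \<mu> (\<Inter>n. ?A n)"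
  proof (rule INF_emeasure_decseq)
    show "decseq ?A" unfolding decseq_def
      by (auto intro: order_trans le_imp_inverse_le simp: field_simps)
  qed (use fin in \<open>auto simp: \<mu>_def em[unfolded \<mu>_def] less_top\<close>)
  also have "(\<Inter>n. ?A n) = {r..\<tau>}"
  proof (intro equalityI subsetI)
    fix x assume x: "x \<in> (\<Inter>n. ?A n)"
    have "x \<le> \<tau>"
    proof (rule ccontr)
      assume "\<not> x \<le> \<tau>"
      then obtain n where "inverse (real (Suc n)) < x - \<tau>" using reals_Archimedean[of "x - \<tau>"] by auto
      thus False using x by (auto dest!: spec[of _ n])
    qed
    thus "x \<in> {r..\<tau>}" using x by auto
  qed (auto intro: add_increasing2)
  finally show ?thesis by (simp only: em)
qed

text \<open>A hitting time is determined by the rate before it. The cumulative integrals agree up to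
  \<tau> inclusive, a single point being null: \<open>g\<close> has done the work by \<tau> because
  \<open>f\<close> has, and an earlier hit of \<open>g\<close> would be one of
  \<open>f\<close>.\<close>

lemma hit_time_cong_AE:
  assumes [measurable]: "f \<in> borel_measurable borel" "g \<in> borel_measurable borel"
    and fin: "\<And>b. (\<integral>\<^sup>+x\<in>{r..b}. ennreal (f x) \<partial>lborel) < \<infinity>"
    and \<tau>: "hit_time (ereal r) w f = ereal \<tau>"
    and eq: "AE x in lborel. r \<le> x \<longrightarrow> x < \<tau> \<longrightarrow> f x = g x"
  shows "hit_time (ereal r) w g = ereal \<tau>"
proof -
  have "AE x in lborel. x \<noteq> \<tau>" by (rule AE_lborel_singleton)
  with eq have same: "(\<integral>\<^sup>+x\<in>{r..t}. ennreal (f x) \<partial>lborel) = (\<integral>\<^sup>+x\<in>{r..t}. ennreal (g x) \<partial>lborel)"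
    if "t \<le> \<tau>" for t
    using that by (intro nn_integral_cong_AE) (auto simp: indicator_def)
  have "r \<le> \<tau>" using hit_time_ge[of "ereal r" w f] \<tau> by simp
  hence "hit_time (ereal r) w g \<le> ereal \<tau>"
    using hit_time_attained[OF assms(1) fin \<tau>] same[of \<tau>] by (intro hit_time_le) auto
  moreover have "\<not> hit_time (ereal r) w g < ereal \<tau>"
  proof
    assume "hit_time (ereal r) w g < ereal \<tau>"
    then obtain t where t: "hit_time (ereal r) w g < ereal t" "t < \<tau>"
      by (metis ereal_dense2 ereal_less(1) less_ereal.simps(1))
    hence "hit_time (ereal r) w f \<le> ereal t"
      using hit_time_lessD[OF t(1)] same[of t] by (intro hit_time_le) auto
    thus False using t \<tau> by simp
  qed
  ultimately show ?thesis by order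
qed

text \<open>No excess work is done: at every time before \<tau> the cumulative integral is still
  below \<open>w\<close>, so the sublevel bound applies to the rate cut off at \<tau>. The converse
  is attainment, up to a null endpoint.\<close>

lemma hit_time_work:
  assumes [measurable]: "f \<in> borel_measurable borel"
    and fin: "\<And>b. (\<integral>\<^sup>+x\<in>{r..b}. ennreal (f x) \<partial>lborel) < \<infinity>"
    and \<tau>: "hit_time (ereal r) w f = ereal \<tau>"
  shows "(\<integral>\<^sup>+x\<in>{r..<\<tau>}. ennreal (f x) \<partial>lborel) = ennreal w"
proof (rule antisym)
  let ?f = "\<lambda>x. ennreal (f x) * indicator {r..<\<tau>} x"
  have "(\<integral>\<^sup>+y\<in>{..t}. ?f y \<partial>lborel) < ennreal w" if "r \<le> t" "t < \<tau>" for t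
  proof -
    have "(\<integral>\<^sup>+y\<in>{..t}. ?f y \<partial>lborel) \<le> (\<integral>\<^sup>+y\<in>{r..t}. ennreal (f y) \<partial>lborel)"
      by (intro nn_integral_mono) (auto simp: indicator_def)
    moreover have "\<not> hit_time (ereal r) w f \<le> ereal t" using \<tau> that by simp
    ultimately show ?thesis using hit_time_le[OF that(1)] by (meson not_le order_le_less_trans)
  qed
  hence "(\<integral>\<^sup>+x. ?f x \<partial>lborel) \<le> (\<integral>\<^sup>+x\<in>{t. (\<integral>\<^sup>+y\<in>{..t}. ?f y \<partial>lborel) < ennreal w}. ?f x \<partial>lborel)"
    by (intro nn_integral_mono) (auto split: split_indicator)
  also have "\<dots> \<le> ennreal w" by (rule nn_integral_sublevel_le) measurable
  finally show "(\<integral>\<^sup>+x. ?f x \<partial>lborel) \<le> ennreal w" .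
  have "ennreal w \<le> (\<integral>\<^sup>+x\<in>{r..\<tau>}. ennreal (f x) \<partial>lborel)" by (rule hit_time_attained[OF assms])
  also have "\<dots> = (\<integral>\<^sup>+x. ?f x \<partial>lborel)"
    using AE_lborel_singleton[of \<tau>] by (intro nn_integral_cong_AE) (auto simp: indicator_def)
  finally show "ennreal w \<le> (\<integral>\<^sup>+x. ?f x \<partial>lborel)" .
qed

section \<open>Valid schedules\<close>

abbreviation work :: "job list \<Rightarrow> nat \<Rightarrow> nat \<Rightarrow> real" where
  "work J i k \<equiv> fst (phases (J ! i) ! k)"

abbreviation par :: "job list \<Rightarrow> nat \<Rightarrow> nat \<Rightarrow> ereal" where
  "par J i k \<equiv> snd (phases (J ! i) ! k)"

abbreviation num_phases :: "job list \<Rightarrow> nat \<Rightarrow> nat" where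
  "num_phases J i \<equiv> length (phases (J ! i))"

lemma job_setD:
  assumes "job_set J" "i < length J"
  shows "0 \<le> release (J ! i)" "0 < num_phases J i"
    and "k < num_phases J i \<Longrightarrow> 0 < work J i k" "k < num_phases J i \<Longrightarrow> 1 \<le> par J i k"
proof -
  have "J ! i \<in> set J" using assms by simp
  hence *: "0 \<le> release (J ! i)" "phases (J ! i) \<noteq> []"
    "\<And>ph. ph \<in> set (phases (J ! i)) \<Longrightarrow> 0 < fst ph \<and> 1 \<le> snd ph"
    using assms(1) unfolding job_set_def by (auto simp: case_prod_beta)
  show "0 \<le> release (J ! i)" "0 < num_phases J i" using * by auto
  show "k < num_phases J i \<Longrightarrow> 0 < work J i k" "k < num_phases J i \<Longrightarrow> 1 \<le> par J i k"
    using *(3)[of "phases (J ! i) ! k"] by auto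
qed

lemma job_set_par_nonneg:
  "job_set J \<Longrightarrow> i < length J \<Longrightarrow> k < num_phases J i \<Longrightarrow> 0 \<le> par J i k"
  using job_setD(4)[of J i k] by (auto intro: order_trans[of 0 1])

lemma phase_end_mono: "k \<le> l \<Longrightarrow> phase_end P J S i k \<le> phase_end P J S i l"
  by (rule lift_Suc_mono_le[of "phase_end P J S i"]) (simp_all only: phase_end_Suc hit_time_ge)

lemma borel_measurable_Max_image:
  fixes f :: "'b \<Rightarrow> 'a \<Rightarrow> real"
  assumes "finite I" "I \<noteq> {}" "\<And>i. i \<in> I \<Longrightarrow> f i \<in> borel_measurable M"
  shows "(\<lambda>x. Max ((\<lambda>i. f i x) ` I)) \<in> borel_measurable M"
  using assms
proof (induction I rule: finite_ne_induct)
  case (insert i I)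
  have "(\<lambda>x. max (f i x) (Max ((\<lambda>i. f i x) ` I))) \<in> borel_measurable M"
    using insert by (intro borel_measurable_max) auto
  thus ?case using insert by simp
qed simp

lemma borel_measurable_exec_rate:
  assumes "0 \<le> h" and "\<And>p t. p < P \<Longrightarrow> 0 \<le> speed S t p"
    and "\<And>p. p < P \<Longrightarrow> speed_for S i p \<in> borel_measurable borel"
  shows "exec_rate P S i h \<in> borel_measurable borel"
proof -
  let ?F = "{B. B \<subseteq> {..<P} \<and> ereal (real (card B)) \<le> h}"
  have eq: "exec_rate P S i h = (\<lambda>t. Max ((\<lambda>B. \<Sum>p\<in>B. speed_for S i p t) ` ?F))"
    using assms(2) by (intro ext exec_rate_eq_Max[OF assms(1)]) auto
  have "finite ?F" by (rule finite_subset[of _ "Pow {..<P}"]) auto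
  moreover have "{} \<in> ?F" using assms(1) by (simp flip: zero_ereal_def)
  ultimately show ?thesis unfolding eq
    by (intro borel_measurable_Max_image borel_measurable_sum assms(3)) auto
qed

lemma sum_indicator_le_1:
  assumes "finite I" "\<And>i j. i \<in> I \<Longrightarrow> j \<in> I \<Longrightarrow> Q i \<Longrightarrow> Q j \<Longrightarrow> i = j"
  shows "(\<Sum>i\<in>I. of_bool (Q i)) \<le> (1::real)"
proof (cases "\<exists>i\<in>I. Q i")
  case True
  then obtain i where i: "i \<in> I" "Q i" by blast
  hence "(\<Sum>i\<in>I. of_bool (Q i)) = (\<Sum>j\<in>{i}. of_bool (Q j) :: real)"
    using assms by (intro sum.mono_neutral_right) auto
  thus ?thesis using i by simp
next
  case False
  hence "(\<Sum>i\<in>I. of_bool (Q i)) = (0::real)" by (intro sum.neutral) auto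
  thus ?thesis by simp
qed

lemma nn_integral_double_sum:
  assumes "\<And>i k. i < n \<Longrightarrow> k < m i \<Longrightarrow> f i k \<in> borel_measurable M"
  shows "(\<integral>\<^sup>+t. (\<Sum>i<n. \<Sum>k<m i. f i k t) \<partial>M) = (\<Sum>i<n::nat. \<Sum>k<m i::nat. \<integral>\<^sup>+t. f i k t \<partial>M)"
proof -
  have "(\<integral>\<^sup>+t. (\<Sum>i<n. \<Sum>k<m i. f i k t) \<partial>M) = (\<Sum>i<n. \<integral>\<^sup>+t. (\<Sum>k<m i. f i k t) \<partial>M)"
    using assms by (intro nn_integral_sum borel_measurable_sum) auto
  also have "\<dots> = (\<Sum>i<n. \<Sum>k<m i. \<integral>\<^sup>+t. f i k t \<partial>M)"
    using assms by (intro sum.cong refl nn_integral_sum) auto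
  finally show ?thesis .
qed

lemma ennreal_double_sum:
  assumes "\<And>i k. i < n \<Longrightarrow> k < m i \<Longrightarrow> 0 \<le> f i k"
  shows "ennreal (\<Sum>i<n::nat. \<Sum>k<m i::nat. f i k) = (\<Sum>i<n. \<Sum>k<m i. ennreal (f i k))"
proof -
  have "ennreal (\<Sum>i<n. \<Sum>k<m i. f i k) = (\<Sum>i<n. ennreal (\<Sum>k<m i. f i k))"
    using assms by (intro sum_ennreal[symmetric] sum_nonneg) auto
  also have "\<dots> = (\<Sum>i<n. \<Sum>k<m i. ennreal (f i k))"
    using assms by (intro sum.cong refl sum_ennreal[symmetric]) auto
  finally show ?thesis .
qed

section \<open>Phases, active jobs and flow time of a valid schedule\<close>

locale job_schedule =
  fixes \<alpha> :: real and P :: nat and J :: "job list" and S :: schedule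
  assumes alpha: "1 < \<alpha>" and jobs: "job_set J" and valid: "valid_schedule P J S"
begin

definition pend :: "nat \<Rightarrow> nat \<Rightarrow> real" where
  "pend i k = real_of_ereal (phase_end P J S i k)"

definition compl :: "nat \<Rightarrow> real" where
  "compl i = pend i (num_phases J i)"

text \<open>The cut-off to the half-open phase window makes progress a function on the whole line
  whose cumulative integrals can be compared between schedules with different windows.\<close>

definition phase_rate :: "nat \<Rightarrow> nat \<Rightarrow> real \<Rightarrow> real" where
  "phase_rate i k t = exec_rate P S i (par J i k) t * indicator {pend i k..<pend i (Suc k)} t"

lemmas par_nonneg = job_set_par_nonneg[OF jobs]

lemma speed_nonneg: "p < P \<Longrightarrow> 0 \<le> speed S t p"
  using valid by (auto simp: valid_schedule_def)

lemma speed_measurable: "p < P \<Longrightarrow> (\<lambda>t. speed S t p) \<in> borel_measurable borel"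
  using valid by (auto simp: valid_schedule_def)

lemma speed_for_measurable: "p < P \<Longrightarrow> speed_for S i p \<in> borel_measurable borel"
  unfolding speed_for_def [abs_def] using valid
  by (intro borel_measurable_times borel_measurable_indicator speed_measurable)
     (auto simp: valid_schedule_def)

lemma speed_for_nonneg: "p < P \<Longrightarrow> 0 \<le> speed_for S i p t"
  using speed_nonneg by (auto simp: speed_for_def)

lemma sum_speed_for_le:
  assumes "p < P"
  shows "(\<Sum>i<n. speed_for S i p t) \<le> speed S t p"
    and "(\<Sum>i<n. speed_for S i p t powr \<alpha>) \<le> speed S t p powr \<alpha>"
proof -
  have le1: "(\<Sum>i<n. of_bool (owner S t p = Some i)) \<le> (1::real)"
    by (rule sum_indicator_le_1) auto
  have "(\<Sum>i<n. speed_for S i p t) = speed S t p * (\<Sum>i<n. of_bool (owner S t p = Some i))"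
    by (simp add: speed_for_def sum_distrib_left indicator_def)
  also have "\<dots> \<le> speed S t p" using le1 speed_nonneg[OF assms] by (rule mult_left_le)
  finally show "(\<Sum>i<n. speed_for S i p t) \<le> speed S t p" .
  have "(\<Sum>i<n. speed_for S i p t powr \<alpha>) = speed S t p powr \<alpha> * (\<Sum>i<n. of_bool (owner S t p = Some i))"
    unfolding sum_distrib_left by (intro sum.cong) (auto simp: speed_for_def indicator_def)
  also have "\<dots> \<le> speed S t p powr \<alpha>" using le1 by (intro mult_left_le) auto
  finally show "(\<Sum>i<n. speed_for S i p t powr \<alpha>) \<le> speed S t p powr \<alpha>" .
qed

lemma exec_rate_measurable: "0 \<le> h \<Longrightarrow> exec_rate P S i h \<in> borel_measurable borel"
  by (rule borel_measurable_exec_rate[OF _ speed_nonneg speed_for_measurable])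

lemma exec_rate_bounds:
  assumes "0 \<le> h"
  shows "0 \<le> exec_rate P S i h t" "exec_rate P S i h t \<le> (\<Sum>p<P. speed_for S i p t)"
proof -
  obtain B where B: "B \<subseteq> {..<P}" "exec_rate P S i h t = (\<Sum>p\<in>B. speed_for S i p t)"
    using exec_rate_attained[OF assms speed_nonneg] by blast
  show "0 \<le> exec_rate P S i h t"
    unfolding B using B(1) speed_for_nonneg by (intro sum_nonneg) auto
  show "exec_rate P S i h t \<le> (\<Sum>p<P. speed_for S i p t)"
    unfolding B using B(1) speed_for_nonneg by (intro sum_mono2) auto
qed

lemma speed_before_0: "t < 0 \<Longrightarrow> p < P \<Longrightarrow> speed S t p = 0"
proof -
  assume "t < 0" "p < P"
  have "owner S t p = None"
  proof (rule ccontr)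
    assume "owner S t p \<noteq> None"
    then obtain i where "owner S t p = Some i" by auto
    hence "i < length J" "release (J ! i) \<le> t"
      using valid \<open>p < P\<close> unfolding valid_schedule_def by blast+
    thus False using job_setD(1)[OF jobs, of i] \<open>t < 0\<close> by simp
  qed
  thus "speed S t p = 0" using valid \<open>p < P\<close> unfolding valid_schedule_def by blast
qed

lemma energy_eq: "energy \<alpha> P S = (\<integral>\<^sup>+t. ennreal (\<Sum>p<P. speed S t p powr \<alpha>) \<partial>lborel)"
  unfolding energy_def by (intro nn_integral_cong) (auto simp: indicator_def speed_before_0)

lemma power_measurable [measurable]: "(\<lambda>t. \<Sum>p<P. speed S t p powr \<alpha>) \<in> borel_measurable borel"
  by (intro borel_measurable_sum powr_real_measurable speed_measurable) auto

lemma phase_end_eq: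
  assumes "i < length J" "k \<le> num_phases J i"
  shows "phase_end P J S i k = ereal (pend i k)"
proof -
  have "phase_end P J S i k \<le> phase_end P J S i (num_phases J i)" using assms by (intro phase_end_mono)
  also have "\<dots> < \<infinity>" using valid assms by (auto simp: valid_schedule_def completion_def)
  finally have "phase_end P J S i k < \<infinity>" .
  moreover have "ereal (release (J ! i)) \<le> phase_end P J S i k"
    using phase_end_mono[of 0 k P J S i] by simp
  ultimately show ?thesis unfolding pend_def by (cases "phase_end P J S i k") auto
qed

lemma pend_mono: "i < length J \<Longrightarrow> k \<le> l \<Longrightarrow> l \<le> num_phases J i \<Longrightarrow> pend i k \<le> pend i l"
  using phase_end_mono[of k l P J S i] by (simp add: phase_end_eq)

lemma pend_0: "pend i 0 = release (J ! i)" by (simp add: pend_def)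

lemma release_le_pend: "i < length J \<Longrightarrow> k \<le> num_phases J i \<Longrightarrow> release (J ! i) \<le> pend i k"
  using pend_mono[of i 0 k] by (simp add: pend_0)

lemma completion_eq: "i < length J \<Longrightarrow> completion P J S i = ereal (compl i)"
  by (simp add: completion_def compl_def phase_end_eq)

lemma active_iff: "i < length J \<Longrightarrow> active P J S i t \<longleftrightarrow> release (J ! i) \<le> t \<and> t \<le> compl i"
  by (simp add: active_def completion_eq)

lemma in_phase_iff:
  "i < length J \<Longrightarrow> in_phase P J S i k t \<longleftrightarrow> k < num_phases J i \<and> pend i k \<le> t \<and> t < pend i (Suc k)"
  unfolding in_phase_def by (cases "k < num_phases J i") (auto simp: phase_end_eq simp del: phase_end.simps)

lemma phase_exists:
  assumes "i < length J" "release (J ! i) \<le> t" "t < compl i"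
  shows "\<exists>k<num_phases J i. pend i k \<le> t \<and> t < pend i (Suc k)"
proof -
  let ?k = "LEAST k. t < pend i k"
  have lt: "t < pend i ?k" using assms(3) unfolding compl_def by (rule LeastI)
  hence "?k \<noteq> 0" using assms(2) pend_0[of i] by (metis not_less)
  then obtain k where k: "?k = Suc k" using not0_implies_Suc by blast
  have "?k \<le> num_phases J i" using assms(3) unfolding compl_def by (rule Least_le)
  moreover have "pend i k \<le> t" using k by (metis lessI not_less not_less_Least)
  ultimately show ?thesis using lt unfolding k by (intro exI[of _ k]) auto
qed

lemma phase_unique:
  assumes "i < length J" "k < num_phases J i" "l < num_phases J i"
    "pend i k \<le> t" "t < pend i (Suc k)" "pend i l \<le> t" "t < pend i (Suc l)"
  shows "k = l"
proof (rule ccontr)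
  assume "k \<noteq> l"
  then consider "Suc k \<le> l" | "Suc l \<le> k" by linarith
  thus False using assms pend_mono[of i "Suc k" l] pend_mono[of i "Suc l" k] by cases auto
qed

lemma phase_rate_measurable:
  assumes "i < length J" "k < num_phases J i"
  shows "phase_rate i k \<in> borel_measurable borel"
  unfolding phase_rate_def [abs_def] using exec_rate_measurable[OF par_nonneg[OF assms]]
  by measurable

lemma phase_rate_nonneg: "i < length J \<Longrightarrow> k < num_phases J i \<Longrightarrow> 0 \<le> phase_rate i k t"
  unfolding phase_rate_def using exec_rate_bounds[OF par_nonneg] by simp

lemma phase_rate_before_release:
  "i < length J \<Longrightarrow> k < num_phases J i \<Longrightarrow> t < release (J ! i) \<Longrightarrow> phase_rate i k t = 0"
  unfolding phase_rate_def using release_le_pend[of i k] by (auto simp: indicator_def)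

lemma hit_time_pend:
  assumes "i < length J" "k < num_phases J i"
  shows "hit_time (ereal (pend i k)) (work J i k) (exec_rate P S i (par J i k)) = ereal (pend i (Suc k))"
  using phase_end_Suc[of P J S i k] phase_end_eq[OF assms(1), of k] phase_end_eq[OF assms(1), of "Suc k"] assms
  by (simp del: phase_end.simps)

lemma ennreal_phase_rate:
  "ennreal (phase_rate i k t) = ennreal (exec_rate P S i (par J i k) t) * indicator {pend i k..<pend i (Suc k)} t"
  by (simp add: phase_rate_def indicator_def)

text \<open>Reaching the work at \<open>t\<close> would put the end of the phase at or before
  \<open>t\<close>. The strictness matters: together with \<open>finished_work\<close> it shows that
  a schedule still inside a phase lags behind any finite-energy schedule that has finished
  it.\<close>

lemma unfinished_work:
  assumes "i < length J" "k < num_phases J i" "pend i k \<le> t" "t < pend i (Suc k)"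
  shows "(\<integral>\<^sup>+x\<in>{..t}. ennreal (phase_rate i k x) \<partial>lborel) < ennreal (work J i k)"
proof -
  have "(\<integral>\<^sup>+x\<in>{..t}. ennreal (phase_rate i k x) \<partial>lborel)
     \<le> (\<integral>\<^sup>+x\<in>{pend i k..t}. ennreal (exec_rate P S i (par J i k) x) \<partial>lborel)"
    unfolding ennreal_phase_rate by (intro nn_integral_mono) (auto simp: indicator_def)
  moreover have "\<not> hit_time (ereal (pend i k)) (work J i k) (exec_rate P S i (par J i k)) \<le> ereal t"
    using assms by (simp add: hit_time_pend)
  ultimately show ?thesis using hit_time_le[OF assms(3)] by (meson not_le order_le_less_trans)
qed

text \<open>At any time at most one phase of a job makes progress, so a bound for each single phase
  survives the summation over all of them.\<close>

lemma sum_phase_rate_le: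
  assumes "i < length J"
    and "\<And>k. k < num_phases J i \<Longrightarrow> c k * exec_rate P S i (par J i k) t \<le> b" and "0 \<le> b"
  shows "(\<Sum>k<num_phases J i. c k * phase_rate i k t)
    \<le> b * of_bool (release (J ! i) \<le> t \<and> t \<le> compl i)"
proof (cases "release (J ! i) \<le> t \<and> t \<le> compl i")
  case True
  let ?Q = "\<lambda>k. pend i k \<le> t \<and> t < pend i (Suc k)"
  have "(\<Sum>k<num_phases J i. c k * phase_rate i k t) \<le> (\<Sum>k<num_phases J i. b * of_bool (?Q k))"
    using assms(2) by (intro sum_mono) (auto simp: phase_rate_def indicator_def)
  also have "\<dots> = b * (\<Sum>k<num_phases J i. of_bool (?Q k))" by (simp add: sum_distrib_left)
  also have "\<dots> \<le> b * 1"
    using assms(3) phase_unique[OF assms(1)] by (intro mult_left_mono sum_indicator_le_1) auto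
  finally show ?thesis using True by simp
next
  case False
  have "phase_rate i k t = 0" if "k < num_phases J i" for k
    using that False release_le_pend[OF assms(1), of k] pend_mono[OF assms(1), of "Suc k" "num_phases J i"]
    by (auto simp: phase_rate_def indicator_def compl_def)
  thus ?thesis using False assms(3) by simp
qed

lemma num_active_eq: "real (num_active P J S t) = (\<Sum>i<length J. of_bool (release (J ! i) \<le> t \<and> t \<le> compl i))"
proof -
  have "num_active P J S t = card {i\<in>{..<length J}. release (J ! i) \<le> t \<and> t \<le> compl i}"
    unfolding num_active_def by (intro arg_cong[where f=card]) (auto simp: active_iff)
  thus ?thesis by (simp add: sum.If_cases of_bool_def Int_def)
qed

lemma num_active_measurable [measurable]: "num_active P J S \<in> measurable borel (count_space UNIV)"
proof -
  have "num_active P J S = (\<lambda>t. card {i\<in>{..<length J}. release (J ! i) \<le> t \<and> t \<le> compl i})"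
    unfolding num_active_def by (intro ext arg_cong[where f=card]) (auto simp: active_iff)
  also have "\<dots> = (\<lambda>t. \<Sum>i<length J. of_bool (release (J ! i) \<le> t \<and> t \<le> compl i))"
    by (intro ext) (simp add: sum.If_cases of_bool_def Int_def)
  finally show ?thesis unfolding of_bool_def by simp
qed

lemma flow_time_eq: "flow_time P J S = (\<integral>\<^sup>+t. ennreal (real (num_active P J S t)) \<partial>lborel)"
proof -
  have "(\<integral>\<^sup>+t. ennreal (real (num_active P J S t)) \<partial>lborel)
    = (\<integral>\<^sup>+t. (\<Sum>i<length J. indicator {release (J ! i)..compl i} t) \<partial>lborel)"
    unfolding num_active_eq
    by (intro nn_integral_cong, subst sum_ennreal[symmetric])
       (auto simp: indicator_def ennreal_of_nat_eq_real_of_nat intro!: sum.cong)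
  also have "\<dots> = (\<Sum>i<length J. emeasure lborel {release (J ! i)..compl i})"
    by (simp add: nn_integral_sum)
  also have "\<dots> = flow_time P J S"
    unfolding flow_time_def
  proof (intro sum.cong refl)
    fix i assume "i \<in> {..<length J}"
    hence i: "i < length J" by simp
    have "release (J ! i) \<le> compl i" using release_le_pend[OF i] by (simp add: compl_def)
    thus "emeasure lborel {release (J ! i)..compl i} = e2ennreal (completion P J S i - ereal (release (J ! i)))"
      by (simp add: completion_eq[OF i] e2ennreal_ereal)
  qed
  finally show ?thesis ..
qed

lemma flow_time_finite: "flow_time P J S < \<infinity>"
  unfolding flow_time_def by (auto simp: completion_eq)

end

text \<open>Finite energy excludes infinite work in bounded time, which attainment of phase ends
  relies on. A competing schedule of infinite energy has infinite cost and is dealt with separately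
  at the end.\<close>

locale finite_energy_schedule = job_schedule +
  assumes energy_finite: "energy \<alpha> P S < \<infinity>"
begin

lemma exec_rate_locally_integrable:
  assumes "0 \<le> h"
  shows "(\<integral>\<^sup>+x\<in>{a..b}. ennreal (exec_rate P S i h x) \<partial>lborel) < \<infinity>"
proof -
  have "exec_rate P S i h x \<le> real P + (\<Sum>p<P. speed S x p powr \<alpha>)" for x
  proof -
    have "exec_rate P S i h x \<le> (\<Sum>p<P. speed_for S i p x)" by (rule exec_rate_bounds[OF assms])
    also have "\<dots> \<le> (\<Sum>p<P. 1 + speed S x p powr \<alpha>)"
    proof (intro sum_mono)
      fix p assume "p \<in> {..<P}"
      hence p: "0 \<le> speed S x p" using speed_nonneg by auto
      have "speed_for S i p x \<le> speed S x p" using p by (auto simp: speed_for_def indicator_def)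
      also have "\<dots> \<le> 1 + speed S x p powr \<alpha>" using young_powr[OF alpha, of 1 1] p by simp
      finally show "speed_for S i p x \<le> 1 + speed S x p powr \<alpha>" .
    qed
    finally show ?thesis by (simp add: sum.distrib)
  qed
  hence "(\<integral>\<^sup>+x\<in>{a..b}. ennreal (exec_rate P S i h x) \<partial>lborel)
     \<le> (\<integral>\<^sup>+x. ennreal (real P) * indicator {a..b} x + ennreal (\<Sum>p<P. speed S x p powr \<alpha>) \<partial>lborel)"
    by (intro nn_integral_mono)
       (auto split: split_indicator simp flip: ennreal_plus simp: sum_nonneg intro!: ennreal_leI)
  also have "\<dots> = ennreal (real P) * emeasure lborel {a..b} + energy \<alpha> P S"
    by (simp add: nn_integral_add nn_integral_cmult_indicator energy_eq)
  also have "\<dots> < \<infinity>" using energy_finite by (auto simp: ennreal_mult_less_top emeasure_lborel_Icc_eq)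
  finally show ?thesis .
qed

lemma integral_phase_rate:
  assumes "i < length J" "k < num_phases J i"
  shows "(\<integral>\<^sup>+t. ennreal (phase_rate i k t) \<partial>lborel) = ennreal (work J i k)"
  unfolding ennreal_phase_rate
  by (rule hit_time_work[OF exec_rate_measurable exec_rate_locally_integrable hit_time_pend])
     (use assms par_nonneg in auto)

lemma finished_work:
  assumes "i < length J" "k < num_phases J i" "pend i (Suc k) \<le> t"
  shows "(\<integral>\<^sup>+x\<in>{..t}. ennreal (phase_rate i k x) \<partial>lborel) = ennreal (work J i k)"
  unfolding integral_phase_rate[OF assms(1,2), symmetric] using assms(3)
  by (intro nn_integral_cong) (auto simp: phase_rate_def indicator_def)

text \<open>By Young's inequality on each of the at most \<open>H\<close> useful processors, the rate of a job
  divided by \<open>H powr (1 - 1/\<alpha>)\<close> is at most \<open>1\<close> plus the power spent on the job.\<close>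

lemma limited_work_le_cost:
  defines "H \<equiv> \<lambda>i k. real (nat \<lfloor>real_of_ereal (par J i k)\<rfloor>)"
  shows "(\<Sum>i<length J. \<Sum>k<num_phases J i.
      ennreal (of_bool (par J i k \<noteq> \<infinity>) * H i k powr (- (1 - 1/\<alpha>)) * work J i k))
    \<le> flow_time P J S + energy \<alpha> P S"
proof -
  define c where "c i k = of_bool (par J i k \<noteq> \<infinity>) * H i k powr (- (1 - 1/\<alpha>))" for i k
  have c_nonneg: "0 \<le> c i k" for i k by (simp add: c_def)
  have rate: "c i k * exec_rate P S i (par J i k) t \<le> 1 + (\<Sum>p<P. speed_for S i p t powr \<alpha>)"
    if i: "i < length J" and k: "k < num_phases J i" for i k t
  proof (cases "par J i k = \<infinity>")
    case True
    thus ?thesis by (simp add: c_def sum_nonneg add_nonneg_nonneg)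
  next
    case False
    then obtain h where h: "par J i k = ereal h" "1 \<le> h"
      using job_setD(4)[OF jobs i k] by (cases "par J i k") auto
    have H: "1 \<le> H i k" "H i k = of_int \<lfloor>h\<rfloor>" using h by (auto simp: H_def le_nat_iff le_floor_iff)
    obtain B where B: "B \<subseteq> {..<P}" "ereal (real (card B)) \<le> par J i k"
        "exec_rate P S i (par J i k) t = (\<Sum>p\<in>B. speed_for S i p t)"
      using exec_rate_attained[OF par_nonneg[OF i k] speed_nonneg] by blast
    have "int (card B) \<le> \<lfloor>h\<rfloor>" using B(2) h by (simp add: le_floor_iff)
    hence card_B: "real (card B) \<le> H i k" unfolding H(2) by linarith
    have "c i k * exec_rate P S i (par J i k) t = (\<Sum>p\<in>B. (1 / H i k) powr (1 - 1/\<alpha>) * speed_for S i p t)"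
      unfolding B(3) c_def sum_distrib_left powr_minus
      using False H(1) by (intro sum.cong refl) (simp add: powr_divide field_simps)
    \<comment> \<open>Young with x = 1 / H and \<epsilon> = 1. The terms 1 / H add up to at most 1
      since \<open>B\<close> has at most H elements.\<close>
    also have "\<dots> \<le> (\<Sum>p\<in>B. 1 * (1 / H i k) + 1 powr (1 - \<alpha>) * speed_for S i p t powr \<alpha>)"
      using B(1) H(1) alpha speed_for_nonneg by (intro sum_mono young_powr) auto
    also have "\<dots> = real (card B) / H i k + (\<Sum>p\<in>B. speed_for S i p t powr \<alpha>)"
      by (simp add: sum.distrib)
    also have "\<dots> \<le> 1 + (\<Sum>p<P. speed_for S i p t powr \<alpha>)"
      using card_B H(1) B(1) by (intro add_mono sum_mono2) auto
    finally show ?thesis .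
  qed
  have pointwise: "(\<Sum>i<length J. \<Sum>k<num_phases J i. c i k * phase_rate i k t)
    \<le> real (num_active P J S t) + (\<Sum>p<P. speed S t p powr \<alpha>)" for t
  proof -
    have "(\<Sum>i<length J. \<Sum>k<num_phases J i. c i k * phase_rate i k t)
      \<le> (\<Sum>i<length J. (1 + (\<Sum>p<P. speed_for S i p t powr \<alpha>)) * of_bool (release (J ! i) \<le> t \<and> t \<le> compl i))"
      using rate c_nonneg by (intro sum_mono sum_phase_rate_le) (auto intro!: add_nonneg_nonneg sum_nonneg)
    also have "\<dots> \<le> (\<Sum>i<length J. of_bool (release (J ! i) \<le> t \<and> t \<le> compl i)
        + (\<Sum>p<P. speed_for S i p t powr \<alpha>))"
      by (intro sum_mono) (auto intro!: sum_nonneg)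
    also have "\<dots> = real (num_active P J S t) + (\<Sum>p<P. \<Sum>i<length J. speed_for S i p t powr \<alpha>)"
      unfolding num_active_eq sum.distrib by (subst sum.swap) simp
    also have "\<dots> \<le> real (num_active P J S t) + (\<Sum>p<P. speed S t p powr \<alpha>)"
      using sum_speed_for_le(2) by (intro add_left_mono sum_mono) auto
    finally show ?thesis .
  qed
  \<comment> \<open>The work of a phase is the integral of its progress in this schedule, so a
    quantity of the job set alone turns into a time integral to which the pointwise bound
    applies.\<close>
  have "(\<Sum>i<length J. \<Sum>k<num_phases J i. ennreal (c i k * work J i k))
    = (\<Sum>i<length J. \<Sum>k<num_phases J i. \<integral>\<^sup>+t. ennreal (c i k * phase_rate i k t) \<partial>lborel)"
    using c_nonneg phase_rate_measurable phase_rate_nonneg job_setD(3)[OF jobs]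
    by (intro sum.cong refl) (simp add: ennreal_mult nn_integral_cmult integral_phase_rate less_imp_le)
  also have "\<dots> = (\<integral>\<^sup>+t. (\<Sum>i<length J. \<Sum>k<num_phases J i. ennreal (c i k * phase_rate i k t)) \<partial>lborel)"
    using phase_rate_measurable by (intro nn_integral_double_sum[symmetric]) auto
  also have "\<dots> = (\<integral>\<^sup>+t. ennreal (\<Sum>i<length J. \<Sum>k<num_phases J i. c i k * phase_rate i k t) \<partial>lborel)"
    using c_nonneg phase_rate_nonneg by (intro nn_integral_cong ennreal_double_sum[symmetric]) auto
  also have "\<dots> \<le> (\<integral>\<^sup>+t. ennreal (real (num_active P J S t)) + ennreal (\<Sum>p<P. speed S t p powr \<alpha>) \<partial>lborel)"
    using pointwise
    by (intro nn_integral_mono, subst ennreal_plus[symmetric]) (auto intro!: ennreal_leI sum_nonneg)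
  also have "\<dots> = flow_time P J S + energy \<alpha> P S"
    by (simp add: nn_integral_add flow_time_eq energy_eq)
  finally show ?thesis unfolding c_def .
qed

end

section \<open>Schedules of U-CEQ\<close>

definition rate_const :: "real \<Rightarrow> real" where "rate_const \<alpha> = (\<alpha> - 1) powr (- (1/\<alpha>))"

lemma uniform_rate_eq:
  assumes "1 < \<alpha>"
  shows "real a * (1 / ((\<alpha> - 1) * real a)) powr (1 / \<alpha>) = rate_const \<alpha> * real a powr (1 - 1/\<alpha>)"
proof (cases "a = 0")
  case False
  have "(1 / ((\<alpha> - 1) * real a)) powr (1 / \<alpha>) = rate_const \<alpha> * real a powr (- (1/\<alpha>))"
    using assms False by (simp add: rate_const_def powr_divide powr_mult powr_minus_divide)
  moreover have "real a * real a powr (- (1/\<alpha>)) = real a powr (1 + - (1/\<alpha>))"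
    using False unfolding powr_add by simp
  ultimately show ?thesis by simp
qed simp

locale uceq = job_schedule +
  assumes uceq: "uceq_schedule \<alpha> P J S"
begin

abbreviation \<kappa> :: real where "\<kappa> \<equiv> rate_const \<alpha>"

lemma kappa_pos: "0 < \<kappa>" using alpha by (simp add: rate_const_def)

lemma alloc_in_phase:
  assumes "i < length J" "k < num_phases J i" "pend i k \<le> t" "t < pend i (Suc k)"
  shows "alloc P S i t = whole (par J i k) (real P / real (num_active P J S t))"
    and "p < P \<Longrightarrow> owner S t p = Some i \<Longrightarrow> speed S t p = (1 / ((\<alpha> - 1) * real (alloc P S i t))) powr (1 / \<alpha>)"
  using uceq assms unfolding uceq_schedule_def whole_def by (auto simp: in_phase_iff)

lemma alloc_not_in_phase:
  assumes "i < length J" "\<And>k. k < num_phases J i \<Longrightarrow> pend i k \<le> t \<Longrightarrow> \<not> t < pend i (Suc k)"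
  shows "alloc P S i t = 0"
  using uceq assms unfolding uceq_schedule_def by (auto simp: in_phase_iff)

lemma exec_rate_in_phase:
  assumes "i < length J" "k < num_phases J i" "pend i k \<le> t" "t < pend i (Suc k)"
  shows "phase_rate i k t =
    \<kappa> * real (whole (par J i k) (real P / real (num_active P J S t))) powr (1 - 1/\<alpha>)"
proof -
  define a where "a = alloc P S i t"
  have a: "a = whole (par J i k) (real P / real (num_active P J S t))"
    unfolding a_def by (rule alloc_in_phase[OF assms])
  have "exec_rate P S i (par J i k) t = real a * (1 / ((\<alpha> - 1) * real a)) powr (1 / \<alpha>)"
    unfolding a_def
  proof (rule exec_rate_const_speed)
    show "ereal (real (alloc P S i t)) \<le> par J i k"
      using whole_le_parallelism[OF par_nonneg[OF assms(1,2)]] by (simp add: a[unfolded a_def])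
  qed (use alloc_in_phase[OF assms] par_nonneg assms in auto)
  also have "\<dots> = \<kappa> * real a powr (1 - 1/\<alpha>)" using alpha by (rule uniform_rate_eq)
  finally show ?thesis using assms a by (simp add: phase_rate_def)
qed

text \<open>Each of the \<open>a\<close> processors of a job has power 1 / ((\<alpha> - 1) a), which
  adds up to 1 / (\<alpha> - 1) per job that holds processors; for \<open>a = 0\<close> the product
  is 0. Active jobs without processors make this an inequality.\<close>

lemma power_le: "(\<Sum>p<P. speed S t p powr \<alpha>) \<le> real (num_active P J S t) / (\<alpha> - 1)"
proof -
  have p: "speed S t p powr \<alpha> = (\<Sum>i<length J. of_bool (owner S t p = Some i) * (1 / ((\<alpha> - 1) * real (alloc P S i t))))"
    if "p < P" for p
  proof (cases "owner S t p")
    case None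
    hence "speed S t p = 0" using valid that by (auto simp: valid_schedule_def)
    thus ?thesis using None by simp
  next
    case (Some i)
    hence i: "i < length J" using valid that by (auto simp: valid_schedule_def)
    have "p \<in> {p. p < P \<and> owner S t p = Some i}" using that Some by simp
    hence pos: "0 < alloc P S i t" unfolding alloc_def by (subst card_gt_0_iff) auto
    then obtain k where k: "k < num_phases J i" "pend i k \<le> t" "t < pend i (Suc k)"
      using alloc_not_in_phase[OF i, of t] by fastforce
    have "speed S t p powr \<alpha> = 1 / ((\<alpha> - 1) * real (alloc P S i t))"
      using alloc_in_phase(2)[OF i k that Some] pos alpha by (simp add: powr_powr)
    also have "\<dots> = (\<Sum>j\<in>{i}. of_bool (owner S t p = Some j) * (1 / ((\<alpha> - 1) * real (alloc P S j t))))"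
      using Some by simp
    also have "\<dots> = (\<Sum>j<length J. of_bool (owner S t p = Some j) * (1 / ((\<alpha> - 1) * real (alloc P S j t))))"
      using i Some by (intro sum.mono_neutral_left) auto
    finally show ?thesis .
  qed
  have "(\<Sum>p<P. speed S t p powr \<alpha>)
    = (\<Sum>i<length J. \<Sum>p<P. of_bool (owner S t p = Some i) * (1 / ((\<alpha> - 1) * real (alloc P S i t))))"
    using p by (subst sum.swap) simp
  also have "\<dots> = (\<Sum>i<length J. real (alloc P S i t) * (1 / ((\<alpha> - 1) * real (alloc P S i t))))"
  proof (intro sum.cong refl)
    fix i
    have "(\<Sum>p<P. of_bool (owner S t p = Some i)) = real (card ({..<P} \<inter> {p. owner S t p = Some i}))"
      by simp
    also have "{..<P} \<inter> {p. owner S t p = Some i} = {p. p < P \<and> owner S t p = Some i}" by auto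
    finally show "(\<Sum>p<P. of_bool (owner S t p = Some i) * (1 / ((\<alpha> - 1) * real (alloc P S i t))))
      = real (alloc P S i t) * (1 / ((\<alpha> - 1) * real (alloc P S i t)))"
      unfolding sum_distrib_right[symmetric] alloc_def by simp
  qed
  also have "\<dots> \<le> (\<Sum>i<length J. of_bool (release (J ! i) \<le> t \<and> t \<le> compl i) * (1 / (\<alpha> - 1)))"
  proof (intro sum_mono)
    fix i assume "i \<in> {..<length J}"
    hence i: "i < length J" by simp
    show "real (alloc P S i t) * (1 / ((\<alpha> - 1) * real (alloc P S i t)))
      \<le> of_bool (release (J ! i) \<le> t \<and> t \<le> compl i) * (1 / (\<alpha> - 1))"
    proof (cases "alloc P S i t = 0")
      case False
      then obtain k where k: "k < num_phases J i" "pend i k \<le> t" "t < pend i (Suc k)"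
        using alloc_not_in_phase[OF i, of t] by fastforce
      hence "release (J ! i) \<le> t \<and> t \<le> compl i"
        using release_le_pend[OF i, of k] pend_mono[OF i, of "Suc k" "num_phases J i"]
        by (auto simp: compl_def)
      thus ?thesis using False alpha by simp
    qed (use alpha in auto)
  qed
  also have "\<dots> = real (num_active P J S t) / (\<alpha> - 1)"
    unfolding num_active_eq sum_distrib_right[symmetric] by simp
  finally show ?thesis .
qed

lemma energy_le: "energy \<alpha> P S \<le> ennreal (1 / (\<alpha> - 1)) * flow_time P J S"
proof -
  have "energy \<alpha> P S \<le> (\<integral>\<^sup>+t. ennreal (1 / (\<alpha> - 1)) * ennreal (real (num_active P J S t)) \<partial>lborel)"
    unfolding energy_eq
  proof (intro nn_integral_mono)
    fix t
    have "ennreal (\<Sum>p<P. speed S t p powr \<alpha>) \<le> ennreal (1 / (\<alpha> - 1) * real (num_active P J S t))"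
      using power_le[of t] by (intro ennreal_leI) simp
    thus "ennreal (\<Sum>p<P. speed S t p powr \<alpha>) \<le> ennreal (1 / (\<alpha> - 1)) * ennreal (real (num_active P J S t))"
      using alpha by (subst ennreal_mult[symmetric]) auto
  qed
  also have "\<dots> = ennreal (1 / (\<alpha> - 1)) * flow_time P J S"
    by (simp add: nn_integral_cmult flow_time_eq)
  finally show ?thesis .
qed

sublocale finite_energy_schedule \<alpha> P J S
proof
  have "ennreal (1 / (\<alpha> - 1)) * flow_time P J S < \<infinity>"
    using flow_time_finite by (simp add: ennreal_mult_less_top)
  thus "energy \<alpha> P S < \<infinity>" using energy_le by (rule order_le_less_trans[rotated])
qed

text \<open>Half-open, unlike \<open>active\<close>: before its completion a released job is always
  inside a phase, and the two counts differ only at the finitely many completion times.\<close>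

definition running :: "real \<Rightarrow> nat set" where
  "running t = {i. i < length J \<and> release (J ! i) \<le> t \<and> t < compl i}"

lemma finite_running [simp]: "finite (running t)" by (simp add: running_def)

lemma card_running_le_num_active: "card (running t) \<le> num_active P J S t"
  unfolding num_active_def by (intro card_mono) (auto simp: running_def active_iff)

text \<open>If more than \<open>P\<close> jobs were running, nobody would be allocated a processor before the next
  completion, so the job completing next would have been complete already.\<close>

lemma card_running_le: "card (running t) \<le> P"
proof (rule ccontr)
  assume "\<not> card (running t) \<le> P"
  hence gt: "P < card (running t)" by simp
  hence ne: "running t \<noteq> {}" by auto
  define c where "c = Min (compl ` running t)"
  have "c \<in> compl ` running t" unfolding c_def using ne by (intro Min_in) auto
  then obtain i where i: "i \<in> running t" "compl i = c" by auto
  hence iJ: "i < length J" by (simp add: running_def)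
  have c_le: "c \<le> compl j" if "j \<in> running t" for j unfolding c_def using that by (intro Min_le) auto
  \<comment> \<open>Until \<open>c\<close> no job of \<open>running t\<close> completes and arrivals
    only enlarge the set, so the equal share stays below 1 and is rounded down to 0.\<close>
  have idle: "exec_rate P S i h x = 0" if "t \<le> x" "x < c" for h x
  proof -
    have "running t \<subseteq> running x" using that c_le by (force simp: running_def)
    hence "P < num_active P J S x"
      using gt card_mono[of "running x" "running t"] card_running_le_num_active[of x] by simp
    hence "real P / real (num_active P J S x) < 1" by (simp add: divide_less_eq)
    moreover have "real (whole h' (real P / real (num_active P J S x))) \<le> real P / real (num_active P J S x)"
      if "0 \<le> h'" for h' using that by (intro whole_le) auto
    ultimately have "whole h' (real P / real (num_active P J S x)) = 0" if "0 \<le> h'" for h'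
      using that by (metis less_one of_nat_less_1_iff order_le_less_trans)
    hence "alloc P S i x = 0"
      using alloc_not_in_phase[OF iJ, of x] alloc_in_phase(1)[OF iJ, of _ x] par_nonneg[OF iJ] by metis
    hence "{j. 1 \<le> j \<and> ereal (real j) \<le> min (ereal (real (alloc P S i x))) h} = {}" by auto
    thus ?thesis unfolding exec_rate_def by (simp only: sum.empty)
  qed
  obtain K where K: "num_phases J i = Suc K"
    using job_setD(2)[OF jobs iJ] by (metis gr0_implies_Suc)
  have c: "pend i (Suc K) = c" using i(2) K by (simp add: compl_def)
  \<comment> \<open>After \<open>t'\<close> the last phase of job \<open>i\<close> makes no
    progress, so its whole work is done by \<open>t'\<close>. If the phase starts before
    \<open>c\<close>, then \<open>t'\<close> lies inside it although the work is complete; otherwise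
    its window is empty and its positive work would be 0.\<close>
  define t' where "t' = max t (pend i K)"
  have "(\<integral>\<^sup>+x\<in>{..t'}. ennreal (phase_rate i K x) \<partial>lborel) = (\<integral>\<^sup>+x. ennreal (phase_rate i K x) \<partial>lborel)"
    using idle by (intro nn_integral_cong) (auto simp: phase_rate_def c t'_def indicator_def)
  also have "\<dots> = ennreal (work J i K)" using iJ K by (intro integral_phase_rate) auto
  finally have total: "(\<integral>\<^sup>+x\<in>{..t'}. ennreal (phase_rate i K x) \<partial>lborel) = ennreal (work J i K)" .
  show False
  proof (cases "pend i K < c")
    case True
    moreover have "t < c" using i by (auto simp: running_def)
    ultimately show False using unfinished_work[OF iJ, of K t'] total K c by (auto simp: t'_def)
  next
    case False
    hence "(\<integral>\<^sup>+x\<in>{..t'}. ennreal (phase_rate i K x) \<partial>lborel) = 0"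
      by (simp add: phase_rate_def c)
    thus False using total job_setD(3)[OF jobs iJ, of K] K by simp
  qed
qed

lemma AE_num_active: "AE t in lborel. num_active P J S t = card (running t)"
proof -
  have "AE t in lborel. t \<notin> compl ` {..<length J}"
    by (intro AE_not_in finite_imp_null_set_lborel) auto
  thus ?thesis
  proof eventually_elim
    case (elim t)
    thus ?case unfolding num_active_def
      by (intro arg_cong[where f=card]) (auto simp: running_def active_iff order.order_iff_strict)
  qed
qed

end

section \<open>Comparison with another schedule\<close>

text \<open>Each ordered pair from \<open>M\<close> is comparable in at least one direction, and
  both directions contribute the same total by symmetry.\<close>

lemma sum_card_below_ge:
  fixes r :: "'a \<Rightarrow> 'b::linorder"
  assumes "finite A" "M \<subseteq> A"
  shows "real (card M) ^ 2 \<le> 2 * (\<Sum>i\<in>M. real (card {j\<in>A. r j \<le> r i}))"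
proof -
  have fin: "finite M" using assms by (rule finite_subset[rotated])
  have "real (card M) ^ 2 = (\<Sum>i\<in>M. \<Sum>j\<in>M. 1)" by (simp add: power2_eq_square)
  also have "\<dots> \<le> (\<Sum>i\<in>M. \<Sum>j\<in>M. of_bool (r j \<le> r i) + of_bool (r i \<le> r j))"
    by (intro sum_mono) auto
  also have "\<dots> = 2 * (\<Sum>i\<in>M. \<Sum>j\<in>M. of_bool (r j \<le> r i))"
    unfolding sum.distrib by (subst (2) sum.swap) simp
  also have "\<dots> = 2 * (\<Sum>i\<in>M. real (card (M \<inter> {j. r j \<le> r i})))" using fin by simp
  also have "\<dots> \<le> 2 * (\<Sum>i\<in>M. real (card {j\<in>A. r j \<le> r i}))"
    using assms by (intro mult_left_mono sum_mono of_nat_mono card_mono) auto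
  finally show ?thesis .
qed

text \<open>Chosen such that the flow-time term arising from Young's inequality is exactly half of the
  flow time of U-CEQ.\<close>

definition young_coeff :: "real \<Rightarrow> real" where
  "young_coeff \<alpha> = rate_const \<alpha> / (4 * 2 powr (1 - 1/\<alpha>))"

definition energy_coeff :: "real \<Rightarrow> real" where
  "energy_coeff \<alpha> = 2 * 2 powr (1 - 1/\<alpha>) / rate_const \<alpha> * young_coeff \<alpha> powr (1 - \<alpha>)"

locale competition = A: uceq \<alpha> P J S + O: finite_energy_schedule \<alpha> P J T
  for \<alpha> P J S T +
  assumes P: "1 \<le> P"
begin

abbreviation \<beta> :: real where "\<beta> \<equiv> 1 - 1/\<alpha>"

lemma beta: "0 < \<beta>" "\<beta> < 1" using A.alpha by auto

text \<open>Ranking by release time keeps the rank of a job from increasing during its lifetime, since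
  later arrivals do not count. The ranks of any \<open>m\<close> running jobs still sum to at least
  \<open>m\<^sup>2 / 2\<close>, with ties counted for both jobs.\<close>

definition rank :: "nat \<Rightarrow> real \<Rightarrow> nat" where
  "rank i t = card {j\<in>A.running t. release (J ! j) \<le> release (J ! i)}"

definition lagging :: "nat \<Rightarrow> nat \<Rightarrow> real set" where
  "lagging i k = {t. (\<integral>\<^sup>+x\<in>{..t}. ennreal (A.phase_rate i k x) \<partial>lborel)
     < (\<integral>\<^sup>+x\<in>{..t}. ennreal (O.phase_rate i k x) \<partial>lborel)}"

text \<open>Inverse to the rate, up to \<kappa>: a phase of U-CEQ that is limited by its finite
  parallelism makes weighted progress exactly \<kappa> per unit of time.\<close>

definition limit_weight :: "nat \<Rightarrow> nat \<Rightarrow> real" where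
  "limit_weight i k = of_bool (par J i k \<noteq> \<infinity>) * real (nat \<lfloor>real_of_ereal (par J i k)\<rfloor>) powr (- \<beta>)"

text \<open>Normalizes rank^\<beta> times the U-CEQ rate \<kappa> q^\<beta> to (2 q rank /
  P)^\<beta>. The factor 2 makes up for rounding, as 2 q / P \<ge> 1 / n.\<close>

definition lag_weight :: real where
  "lag_weight = 2 powr \<beta> * real P powr (- \<beta>) / A.\<kappa>"

lemma lag_weight_nonneg: "0 \<le> lag_weight"
  using A.kappa_pos by (simp add: lag_weight_def)

lemma limit_weight_nonneg: "0 \<le> limit_weight i k"
  by (simp add: limit_weight_def)

lemma rank_le: "rank i t \<le> card (A.running t)"
  unfolding rank_def by (intro card_mono) auto

lemma rank_antimono: "release (J ! i) \<le> t \<Longrightarrow> t \<le> u \<Longrightarrow> rank i u \<le> rank i t"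
  unfolding rank_def by (intro card_mono) (auto simp: A.running_def)

lemma rank_measurable [measurable]: "rank i \<in> measurable borel (count_space UNIV)"
proof -
  have "rank i = (\<lambda>t. card {j\<in>{..<length J}. release (J ! j) \<le> t \<and> t < A.compl j \<and> release (J ! j) \<le> release (J ! i)})"
    unfolding rank_def A.running_def by (intro ext arg_cong[where f=card]) auto
  also have "\<dots> = (\<lambda>t. \<Sum>j<length J. of_bool (release (J ! j) \<le> t \<and> t < A.compl j \<and> release (J ! j) \<le> release (J ! i)))"
    by (intro ext) (simp add: sum.If_cases of_bool_def Int_def)
  finally show ?thesis unfolding of_bool_def by simp
qed

text \<open>A released job that is inactive in the other schedule has been completed there, so the
  whole work of phase \<open>k\<close> is done, whereas U-CEQ is still short of it.\<close>

lemma lagging_or_active: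
  assumes i: "i < length J" and k: "k < num_phases J i" "A.pend i k \<le> t" "t < A.pend i (Suc k)"
    and inactive: "\<not> (release (J ! i) \<le> t \<and> t \<le> O.compl i)"
  shows "t \<in> lagging i k"
proof -
  have "release (J ! i) \<le> t" using A.release_le_pend[OF i, of k] k by simp
  hence "O.compl i < t" using inactive by simp
  hence "O.pend i (Suc k) \<le> t"
    using O.pend_mono[OF i, of "Suc k" "num_phases J i"] k by (simp add: O.compl_def)
  thus ?thesis unfolding lagging_def
    using A.unfinished_work[OF i k] O.finished_work[OF i k(1)] by simp
qed

lemma rank_le_lagging_progress:
  assumes i: "i < length J" and k: "k < num_phases J i" "A.pend i k \<le> t" "t < A.pend i (Suc k)"
    and n: "num_active P J S t = card (A.running t)" "0 < card (A.running t)"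
    and unsat: "\<not> par J i k \<le> ereal (real P / real (card (A.running t)))"
  shows "real (rank i t) / real (card (A.running t)) \<le> lag_weight * real (rank i t) powr \<beta> * A.phase_rate i k t"
proof -
  define n where "n = real (card (A.running t))"
  define q where "q = whole (par J i k) (real P / n)"
  have n1: "1 \<le> n" "n \<le> real P" using assms(6) A.card_running_le[of t] by (auto simp: n_def)
  have q_eq: "q = nat \<lfloor>real P / n\<rfloor>"
    using unsat unfolding q_def whole_def n_def by (simp add: min_def)
  have "1 \<le> real P / n" using n1 by (simp add: le_divide_eq)
  hence "1 \<le> \<lfloor>real P / n\<rfloor>" by (simp add: le_floor_iff)
  \<comment> \<open>The floor of a number that is at least 1 exceeds half of it; here P / n \<ge> 1
    because at most P jobs run.\<close>
  hence "real P / n \<le> 2 * real q" unfolding q_eq by linarith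
  hence q: "1 / n \<le> 2 * real q / real P" using P n1 by (simp add: field_simps)
  have rate: "A.phase_rate i k t = A.\<kappa> * real q powr \<beta>"
    using A.exec_rate_in_phase[OF i k] n by (simp add: q_def n_def)
  have "real (rank i t) \<le> n" using rank_le[of i t] by (simp add: n_def)
  hence le1: "real (rank i t) / n \<le> 1" using n1 by simp
  \<comment> \<open>The ratio lies between 0 and 1 and \<beta> < 1. This makes the bound linear in
    the rank, so that ranks can be summed.\<close>
  have "real (rank i t) / n \<le> (real (rank i t) / n) powr \<beta>"
  proof (cases "rank i t = 0")
    case False
    hence "(real (rank i t) / n) powr 1 \<le> (real (rank i t) / n) powr \<beta>"
      using le1 n1 beta by (intro powr_mono') auto
    thus ?thesis using n1 by simp
  qed simp
  also have "\<dots> = real (rank i t) powr \<beta> * (1 / n) powr \<beta>" using n1 by (simp add: powr_divide)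
  also have "\<dots> \<le> real (rank i t) powr \<beta> * (2 * real q / real P) powr \<beta>"
    using q n1 beta by (intro mult_left_mono powr_mono2) auto
  also have "\<dots> = lag_weight * real (rank i t) powr \<beta> * A.phase_rate i k t"
    unfolding rate lag_weight_def powr_minus_divide using A.kappa_pos P
    by (simp add: powr_divide powr_mult)
  finally show ?thesis by (simp add: n_def)
qed

lemma kappa_le_limited_progress:
  assumes i: "i < length J" and k: "k < num_phases J i" "A.pend i k \<le> t" "t < A.pend i (Suc k)"
    and n: "num_active P J S t = card (A.running t)"
    and sat: "par J i k \<le> ereal (real P / real (card (A.running t)))"
  shows "A.\<kappa> \<le> limit_weight i k * A.phase_rate i k t"
proof -
  obtain h where h: "par J i k = ereal h" "1 \<le> h"
    using job_setD(4)[OF A.jobs i k(1)] sat by (cases "par J i k") auto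
  define m where "m = nat \<lfloor>h\<rfloor>"
  have "A.phase_rate i k t = A.\<kappa> * real m powr \<beta>"
    using A.exec_rate_in_phase[OF i k] n sat h by (simp add: whole_def min_def m_def)
  moreover have "0 < m" using h by (simp add: m_def)
  moreover have "limit_weight i k = 1 / real m powr \<beta>"
    unfolding limit_weight_def h powr_minus_divide by (simp add: m_def)
  ultimately show ?thesis by simp
qed

lemma num_active_le:
  assumes n: "num_active P J S t = card (A.running t)"
  shows "real (num_active P J S t) \<le> 2 * real (num_active P J T t)
    + (\<Sum>i<length J. \<Sum>k<num_phases J i. 2 / A.\<kappa> * (limit_weight i k * A.phase_rate i k t))
    + (\<Sum>i<length J. \<Sum>k<num_phases J i.
        2 * lag_weight * (real (rank i t) powr \<beta> * A.phase_rate i k t * indicator (lagging i k) t))"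
proof -
  define n where "n = card (A.running t)"
  define X where "X i = (\<Sum>k<num_phases J i. limit_weight i k * A.phase_rate i k t)" for i
  define Y where "Y i = (\<Sum>k<num_phases J i. real (rank i t) powr \<beta> * A.phase_rate i k t * indicator (lagging i k) t)" for i
  have X_ge: "limit_weight i k * A.phase_rate i k t \<le> X i" if "i < length J" "k < num_phases J i" for i k
    unfolding X_def using that A.phase_rate_nonneg
    by (intro member_le_sum) (auto simp: limit_weight_def)
  have Y_ge: "real (rank i t) powr \<beta> * A.phase_rate i k t * indicator (lagging i k) t \<le> Y i"
    if "i < length J" "k < num_phases J i" for i k
    unfolding Y_def using that A.phase_rate_nonneg by (intro member_le_sum) auto
  have X_nonneg: "0 \<le> X i" if "i < length J" for i
    unfolding X_def using that A.phase_rate_nonneg by (intro sum_nonneg) (auto simp: limit_weight_def)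
  have Y_nonneg: "0 \<le> Y i" if "i < length J" for i
    unfolding Y_def using that A.phase_rate_nonneg by (intro sum_nonneg) auto
  \<comment> \<open>\<open>Op\<close>, \<open>Sat\<close> and the rest \<open>M\<close> realize the
    three kinds of jobs. Defining \<open>Sat\<close> by the threshold
    \<open>A.\<kappa> \<le> X i\<close> instead of by parallelism bounds its size at once, as in
    Markov's inequality.\<close>
  define Op where "Op = {i\<in>A.running t. release (J ! i) \<le> t \<and> t \<le> O.compl i}"
  define Sat where "Sat = {i\<in>A.running t. A.\<kappa> \<le> X i}"
  define M where "M = A.running t - Op - Sat"
  have runD: "i < length J" if "i \<in> A.running t" for i using that by (simp add: A.running_def)
  have M: "real (rank i t) / real n \<le> lag_weight * Y i" if "i \<in> M" for i
  proof -
    have run: "i \<in> A.running t" and i: "i < length J" using that runD by (auto simp: M_def)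
    then obtain k where k: "k < num_phases J i" "A.pend i k \<le> t" "t < A.pend i (Suc k)"
      using A.phase_exists[OF i] by (auto simp: A.running_def)
    have npos: "0 < card (A.running t)" using run by (auto simp: card_gt_0_iff)
    have "t \<in> lagging i k"
      using that run by (intro lagging_or_active[OF i k]) (auto simp: M_def Op_def)
    moreover have "\<not> par J i k \<le> ereal (real P / real (card (A.running t)))"
      using kappa_le_limited_progress[OF i k n] X_ge[OF i k(1)] that run by (auto simp: M_def Sat_def)
    ultimately have "real (rank i t) / real n
        \<le> lag_weight * (real (rank i t) powr \<beta> * A.phase_rate i k t * indicator (lagging i k) t)"
      using rank_le_lagging_progress[OF i k n npos] by (simp add: n_def mult_ac)
    also have "\<dots> \<le> lag_weight * Y i" using Y_ge[OF i k(1)] lag_weight_nonneg by (rule mult_left_mono)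
    finally show ?thesis .
  qed
  have "A.running t \<subseteq> Op \<union> Sat \<union> M" by (auto simp: M_def)
  hence "n \<le> card (Op \<union> Sat \<union> M)" unfolding n_def by (intro card_mono) (auto simp: Op_def Sat_def M_def)
  also have "\<dots> \<le> card Op + card Sat + card M"
    using card_Un_le[of "Op \<union> Sat" M] card_Un_le[of Op Sat] by linarith
  finally have split: "real n \<le> real (card Op) + real (card Sat) + real (card M)" by linarith
  have Op: "real (card Op) \<le> real (num_active P J T t)"
    unfolding num_active_def using runD
    by (intro of_nat_mono card_mono) (auto simp: Op_def O.active_iff)
  have "A.\<kappa> * real (card Sat) = (\<Sum>i\<in>Sat. A.\<kappa>)" by simp
  also have "\<dots> \<le> (\<Sum>i\<in>Sat. X i)" by (intro sum_mono) (simp add: Sat_def)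
  also have "\<dots> \<le> (\<Sum>i<length J. X i)" using runD X_nonneg by (intro sum_mono2) (auto simp: Sat_def)
  finally have Sat: "real (card Sat) \<le> (\<Sum>i<length J. X i) / A.\<kappa>"
    using A.kappa_pos by (simp add: field_simps)
  have M': "real (card M) - real n / 2 \<le> lag_weight * (\<Sum>i<length J. Y i)"
  proof (cases "n = 0")
    case True
    hence "M = {}" by (auto simp: n_def M_def)
    thus ?thesis using True Y_nonneg lag_weight_nonneg by (auto intro!: mult_nonneg_nonneg sum_nonneg)
  next
    case False
    \<comment> \<open>The quadratic rank bound is replaced by the tangent of the square at
      \<open>n\<close>: with m = card M, m^2 \<ge> 2 m n - n^2. Dividing by 2 n gives m - n / 2, so
      half of \<open>n\<close> is lost here and the remaining terms are doubled.\<close>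
    have "0 \<le> (real (card M) - real n)\<^sup>2" by simp
    hence "(2 * real (card M) - real n) * real n \<le> (real (card M))\<^sup>2"
      by (simp add: power2_eq_square algebra_simps)
    also have "\<dots> \<le> 2 * (\<Sum>i\<in>M. real (rank i t))"
      unfolding rank_def by (rule sum_card_below_ge) (auto simp: M_def)
    finally have "real (card M) - real n / 2 \<le> (\<Sum>i\<in>M. real (rank i t) / real n)"
      using False by (simp add: field_simps flip: sum_divide_distrib)
    also have "\<dots> \<le> (\<Sum>i\<in>M. lag_weight * Y i)" using M by (rule sum_mono)
    also have "\<dots> \<le> (\<Sum>i<length J. lag_weight * Y i)"
      using runD Y_nonneg lag_weight_nonneg by (intro sum_mono2) (auto simp: M_def)
    finally show ?thesis by (simp add: sum_distrib_left)
  qed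
  have "real n \<le> 2 * real (num_active P J T t) + 2 / A.\<kappa> * (\<Sum>i<length J. X i) + 2 * lag_weight * (\<Sum>i<length J. Y i)"
    using split Op Sat M' by simp
  thus ?thesis unfolding n n_def X_def Y_def sum_distrib_left .
qed

text \<open>All ranks are at most \<open>n\<close>, and the rates of the jobs add up to at most the
  total speed since each processor serves one job at a time. What is left is n^\<beta> times the
  total speed, split by Young.\<close>

lemma opt_progress_le:
  "(\<Sum>i<length J. \<Sum>k<num_phases J i. 2 * lag_weight * (real (rank i t) powr \<beta> * O.phase_rate i k t))
    \<le> real (num_active P J S t) / 2 + energy_coeff \<alpha> * (\<Sum>p<P. speed T t p powr \<alpha>)"
proof -
  define n where "n = real (num_active P J S t)"
  have rank_n: "real (rank i t) powr \<beta> \<le> n powr \<beta>" for i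
    using rank_le[of i t] A.card_running_le_num_active[of t] beta
    by (intro powr_mono2) (auto simp: n_def)
  have "(\<Sum>i<length J. \<Sum>k<num_phases J i. real (rank i t) powr \<beta> * O.phase_rate i k t)
    \<le> (\<Sum>i<length J. n powr \<beta> * (\<Sum>p<P. speed_for T i p t))"
  proof (intro sum_mono)
    fix i assume "i \<in> {..<length J}"
    hence i: "i < length J" by simp
    have sp: "0 \<le> (\<Sum>p<P. speed_for T i p t)" using O.speed_for_nonneg by (intro sum_nonneg) auto
    have "(\<Sum>k<num_phases J i. real (rank i t) powr \<beta> * O.phase_rate i k t)
      \<le> n powr \<beta> * (\<Sum>p<P. speed_for T i p t) * of_bool (release (J ! i) \<le> t \<and> t \<le> O.compl i)"
      using rank_n O.exec_rate_bounds[OF O.par_nonneg[OF i]] sp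
      by (intro O.sum_phase_rate_le[OF i]) (auto intro!: mult_mono)
    also have "\<dots> \<le> n powr \<beta> * (\<Sum>p<P. speed_for T i p t)" using sp by simp
    finally show "(\<Sum>k<num_phases J i. real (rank i t) powr \<beta> * O.phase_rate i k t)
      \<le> n powr \<beta> * (\<Sum>p<P. speed_for T i p t)" .
  qed
  also have "\<dots> = n powr \<beta> * (\<Sum>p<P. \<Sum>i<length J. speed_for T i p t)"
    by (subst sum.swap) (simp add: sum_distrib_left)
  also have "\<dots> \<le> n powr \<beta> * (\<Sum>p<P. speed T t p)"
    using O.sum_speed_for_le(1) by (intro mult_left_mono sum_mono) auto
  finally have "2 * lag_weight * (\<Sum>i<length J. \<Sum>k<num_phases J i. real (rank i t) powr \<beta> * O.phase_rate i k t)
    \<le> 2 * lag_weight * (n powr \<beta> * (\<Sum>p<P. speed T t p))"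
    using lag_weight_nonneg by (intro mult_left_mono) auto
  \<comment> \<open>The factor P^(-\<beta>) of \<open>lag_weight\<close> turns n^\<beta> into (n /
    P)^\<beta>. Young on each processor with x = n / P then leaves n / (2 P) each, and these add up
    to n / 2 independently of P.\<close>
  also have "\<dots> = (\<Sum>p<P. 2 * 2 powr \<beta> / A.\<kappa> * ((n / real P) powr \<beta> * speed T t p))"
    unfolding lag_weight_def powr_minus_divide sum_distrib_left using P
    by (intro sum.cong refl) (simp add: n_def powr_divide mult_ac)
  also have "\<dots> \<le> (\<Sum>p<P. 2 * 2 powr \<beta> / A.\<kappa> *
      (young_coeff \<alpha> * (n / real P) + young_coeff \<alpha> powr (1 - \<alpha>) * speed T t p powr \<alpha>))"
    using A.kappa_pos O.speed_nonneg A.alpha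
    by (intro sum_mono mult_left_mono young_powr) (auto simp: young_coeff_def n_def)
  also have "\<dots> = (\<Sum>p<P. n / (2 * real P) + energy_coeff \<alpha> * speed T t p powr \<alpha>)"
  proof (intro sum.cong refl)
    fix p
    have half: "2 * 2 powr \<beta> / A.\<kappa> * young_coeff \<alpha> = 1 / 2"
      using A.kappa_pos by (simp add: young_coeff_def)
    have "2 * 2 powr \<beta> / A.\<kappa> *
      (young_coeff \<alpha> * (n / real P) + young_coeff \<alpha> powr (1 - \<alpha>) * speed T t p powr \<alpha>)
      = 1 / 2 * (n / real P) + energy_coeff \<alpha> * speed T t p powr \<alpha>"
      by (simp only: energy_coeff_def distrib_left mult.assoc[symmetric] half)
    thus "2 * 2 powr \<beta> / A.\<kappa> *
      (young_coeff \<alpha> * (n / real P) + young_coeff \<alpha> powr (1 - \<alpha>) * speed T t p powr \<alpha>)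
      = n / (2 * real P) + energy_coeff \<alpha> * speed T t p powr \<alpha>"
      by (simp only: times_divide_times_eq mult_1)
  qed
  also have "\<dots> = n / 2 + energy_coeff \<alpha> * (\<Sum>p<P. speed T t p powr \<alpha>)"
    using P by (simp add: sum.distrib sum_distrib_left)
  finally show ?thesis unfolding n_def by (simp add: sum_distrib_left)
qed

lemma lagging_progress_le:
  assumes i: "i < length J" and k: "k < num_phases J i"
  shows "(\<integral>\<^sup>+t. ennreal (real (rank i t) powr \<beta> * A.phase_rate i k t * indicator (lagging i k) t) \<partial>lborel)
    \<le> (\<integral>\<^sup>+t. ennreal (real (rank i t) powr \<beta> * O.phase_rate i k t) \<partial>lborel)"
proof -
  note [measurable] = A.phase_rate_measurable[OF i k] O.phase_rate_measurable[OF i k]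
  have "(\<integral>\<^sup>+t. ennreal (real (rank i t) powr \<beta> * A.phase_rate i k t * indicator (lagging i k) t) \<partial>lborel)
    = (\<integral>\<^sup>+t\<in>lagging i k. (ennreal (real (rank i t) powr \<beta>) * ennreal (A.phase_rate i k t)) \<partial>lborel)"
    using A.phase_rate_nonneg[OF i k]
    by (intro nn_integral_cong) (auto simp: ennreal_mult split: split_indicator)
  also have "\<dots> \<le> (\<integral>\<^sup>+t. ennreal (real (rank i t) powr \<beta>) * ennreal (O.phase_rate i k t) \<partial>lborel)"
    unfolding lagging_def
  proof (rule weighted_lag_integral_le[where r = "release (J ! i)" and N = "length J"
        and \<rho> = "rank i" and \<phi> = "\<lambda>m. real m powr \<beta>"])
    fix t
    have "card (A.running t) \<le> card {..<length J}" by (intro card_mono) (auto simp: A.running_def)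
    thus "rank i t \<le> length J" using rank_le[of i t] by simp
  next
    show "mono (\<lambda>m. real m powr \<beta>)" using beta by (auto intro!: monoI powr_mono2)
  qed (use A.phase_rate_before_release[OF i k] O.phase_rate_before_release[OF i k] rank_antimono in auto)
  also have "\<dots> = (\<integral>\<^sup>+t. ennreal (real (rank i t) powr \<beta> * O.phase_rate i k t) \<partial>lborel)"
    using O.phase_rate_nonneg[OF i k] by (simp add: ennreal_mult)
  finally show ?thesis .
qed

lemma energy_coeff_nonneg: "0 \<le> energy_coeff \<alpha>"
  using A.kappa_pos by (simp add: energy_coeff_def)

text \<open>The integrated form of the pointwise bounds. Half of the flow time of \<open>S\<close>
  stays on the right: it can be subtracted only after passing to finite reals.\<close>

lemma flow_time_le:
  "flow_time P J S \<le> 2 * flow_time P J T + ennreal (2 / A.\<kappa>) * (flow_time P J T + energy \<alpha> P T)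
    + (ennreal (1/2) * flow_time P J S + ennreal (energy_coeff \<alpha>) * energy \<alpha> P T)"
proof -
  let ?X = "\<lambda>i k t. 2 / A.\<kappa> * (limit_weight i k * A.phase_rate i k t)"
  let ?Y = "\<lambda>i k t. 2 * lag_weight * (real (rank i t) powr \<beta> * A.phase_rate i k t * indicator (lagging i k) t)"
  let ?Z = "\<lambda>i k t. 2 * lag_weight * (real (rank i t) powr \<beta> * O.phase_rate i k t)"
  note mA = A.phase_rate_measurable and mO = O.phase_rate_measurable
  have lag_sets: "lagging i k \<in> sets borel" if "i < length J" "k < num_phases J i" for i k
    unfolding lagging_def using mA[OF that] mO[OF that] by measurable
  have X0: "0 \<le> ?X i k t" and Y0: "0 \<le> ?Y i k t" and Z0: "0 \<le> ?Z i k t"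
    and X_meas: "?X i k \<in> borel_measurable borel" and Y_meas: "?Y i k \<in> borel_measurable borel"
    and Z_meas: "?Z i k \<in> borel_measurable borel"
    if "i < length J" "k < num_phases J i" for i k t
  proof -
    note [measurable] = mA[OF that] mO[OF that] lag_sets[OF that]
    show "0 \<le> ?X i k t" "0 \<le> ?Y i k t" "0 \<le> ?Z i k t"
      using A.phase_rate_nonneg[OF that] O.phase_rate_nonneg[OF that] A.kappa_pos lag_weight_nonneg
      by (auto simp: limit_weight_def)
    show "?X i k \<in> borel_measurable borel" "?Y i k \<in> borel_measurable borel" "?Z i k \<in> borel_measurable borel"
      by measurable
  qed
  have "flow_time P J S \<le> (\<integral>\<^sup>+t. 2 * ennreal (real (num_active P J T t))
      + (\<Sum>i<length J. \<Sum>k<num_phases J i. ennreal (?X i k t))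
      + (\<Sum>i<length J. \<Sum>k<num_phases J i. ennreal (?Y i k t)) \<partial>lborel)"
    unfolding A.flow_time_eq
  proof (rule nn_integral_mono_AE, rule AE_mp[OF A.AE_num_active], intro AE_I2 impI)
    fix t assume elim: "num_active P J S t = card (A.running t)"
    have "ennreal (real (num_active P J S t)) \<le> ennreal (2 * real (num_active P J T t)
      + (\<Sum>i<length J. \<Sum>k<num_phases J i. ?X i k t) + (\<Sum>i<length J. \<Sum>k<num_phases J i. ?Y i k t))"
      using num_active_le[OF elim] by (rule ennreal_leI)
    also have "\<dots> = ennreal (2 * real (num_active P J T t))
      + ennreal (\<Sum>i<length J. \<Sum>k<num_phases J i. ?X i k t) + ennreal (\<Sum>i<length J. \<Sum>k<num_phases J i. ?Y i k t)"
      using X0 Y0 by (intro trans[OF ennreal_plus] arg_cong2[where f=plus] refl ennreal_plus)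
        (auto intro!: add_nonneg_nonneg sum_nonneg)
    also have "\<dots> = 2 * ennreal (real (num_active P J T t))
      + (\<Sum>i<length J. \<Sum>k<num_phases J i. ennreal (?X i k t))
      + (\<Sum>i<length J. \<Sum>k<num_phases J i. ennreal (?Y i k t))"
      using X0 Y0 by (intro arg_cong2[where f=plus] ennreal_double_sum) (auto simp: ennreal_mult)
    finally show "ennreal (real (num_active P J S t)) \<le> 2 * ennreal (real (num_active P J T t))
      + (\<Sum>i<length J. \<Sum>k<num_phases J i. ennreal (?X i k t))
      + (\<Sum>i<length J. \<Sum>k<num_phases J i. ennreal (?Y i k t))" .
  qed
  also have "\<dots> = 2 * flow_time P J T + (\<Sum>i<length J. \<Sum>k<num_phases J i. \<integral>\<^sup>+t. ennreal (?X i k t) \<partial>lborel)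
      + (\<Sum>i<length J. \<Sum>k<num_phases J i. \<integral>\<^sup>+t. ennreal (?Y i k t) \<partial>lborel)"
  proof -
    have X: "(\<lambda>t. \<Sum>i<length J. \<Sum>k<num_phases J i. ennreal (?X i k t)) \<in> borel_measurable lborel"
      using X_meas by (intro borel_measurable_sum measurable_compose[OF _ measurable_ennreal]) auto
    have Y: "(\<lambda>t. \<Sum>i<length J. \<Sum>k<num_phases J i. ennreal (?Y i k t)) \<in> borel_measurable lborel"
      using Y_meas by (intro borel_measurable_sum measurable_compose[OF _ measurable_ennreal]) auto
    have N: "(\<lambda>t. 2 * ennreal (real (num_active P J T t))) \<in> borel_measurable lborel" by measurable
    have "(\<integral>\<^sup>+t. (\<Sum>i<length J. \<Sum>k<num_phases J i. ennreal (?X i k t)) \<partial>lborel)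
        = (\<Sum>i<length J. \<Sum>k<num_phases J i. \<integral>\<^sup>+t. ennreal (?X i k t) \<partial>lborel)"
      using X_meas by (intro nn_integral_double_sum measurable_compose[OF _ measurable_ennreal]) auto
    moreover have "(\<integral>\<^sup>+t. (\<Sum>i<length J. \<Sum>k<num_phases J i. ennreal (?Y i k t)) \<partial>lborel)
        = (\<Sum>i<length J. \<Sum>k<num_phases J i. \<integral>\<^sup>+t. ennreal (?Y i k t) \<partial>lborel)"
      using Y_meas by (intro nn_integral_double_sum measurable_compose[OF _ measurable_ennreal]) auto
    moreover have "(\<integral>\<^sup>+t. 2 * ennreal (real (num_active P J T t)) \<partial>lborel) = 2 * flow_time P J T"
      unfolding O.flow_time_eq by (rule nn_integral_cmult) measurable
    ultimately show ?thesis
      by (simp only: nn_integral_add[OF borel_measurable_add[OF N X] Y] nn_integral_add[OF N X])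
  qed
  also have "(\<Sum>i<length J. \<Sum>k<num_phases J i. \<integral>\<^sup>+t. ennreal (?X i k t) \<partial>lborel)
      = ennreal (2 / A.\<kappa>) * (\<Sum>i<length J. \<Sum>k<num_phases J i. ennreal (limit_weight i k * work J i k))"
    unfolding sum_distrib_left
  proof (intro sum.cong refl)
    fix i k assume "i \<in> {..<length J}" "k \<in> {..<num_phases J i}"
    hence ik: "i < length J" "k < num_phases J i" by auto
    have "(\<integral>\<^sup>+t. ennreal (?X i k t) \<partial>lborel)
      = (\<integral>\<^sup>+t. ennreal (2 / A.\<kappa>) * (ennreal (limit_weight i k) * ennreal (A.phase_rate i k t)) \<partial>lborel)"
      using A.kappa_pos A.phase_rate_nonneg[OF ik] limit_weight_nonneg[of i k]
      by (intro nn_integral_cong trans[OF ennreal_mult] arg_cong2[where f=times] refl ennreal_mult) auto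
    also have "\<dots> = ennreal (2 / A.\<kappa>) * (ennreal (limit_weight i k) * ennreal (work J i k))"
      using mA[OF ik] by (simp add: nn_integral_cmult A.integral_phase_rate[OF ik])
    also have "\<dots> = ennreal (2 / A.\<kappa>) * ennreal (limit_weight i k * work J i k)"
      using job_setD(3)[OF A.jobs ik] limit_weight_nonneg[of i k] by (simp add: ennreal_mult)
    finally show "(\<integral>\<^sup>+t. ennreal (?X i k t) \<partial>lborel) = ennreal (2 / A.\<kappa>) * ennreal (limit_weight i k * work J i k)" .
  qed
  also have "(\<Sum>i<length J. \<Sum>k<num_phases J i. ennreal (limit_weight i k * work J i k))
      \<le> flow_time P J T + energy \<alpha> P T"
    unfolding limit_weight_def by (rule O.limited_work_le_cost)
  \<comment> \<open>The exchange happens here, phase by phase and under the integral; afterwards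
    only the progress of \<open>T\<close> occurs and can be bounded pointwise again.\<close>
  also have "(\<Sum>i<length J. \<Sum>k<num_phases J i. \<integral>\<^sup>+t. ennreal (?Y i k t) \<partial>lborel)
      \<le> (\<Sum>i<length J. \<Sum>k<num_phases J i. \<integral>\<^sup>+t. ennreal (?Z i k t) \<partial>lborel)"
  proof (intro sum_mono)
    fix i k assume "i \<in> {..<length J}" "k \<in> {..<num_phases J i}"
    hence ik: "i < length J" "k < num_phases J i" by auto
    note [measurable] = mA[OF ik] mO[OF ik] lag_sets[OF ik]
    show "(\<integral>\<^sup>+t. ennreal (?Y i k t) \<partial>lborel) \<le> (\<integral>\<^sup>+t. ennreal (?Z i k t) \<partial>lborel)"
      using lagging_progress_le[OF ik] lag_weight_nonneg A.phase_rate_nonneg[OF ik] O.phase_rate_nonneg[OF ik]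
      by (subst (1 2) ennreal_mult) (auto simp: nn_integral_cmult intro!: mult_left_mono)
  qed
  also have "\<dots> = (\<integral>\<^sup>+t. ennreal (\<Sum>i<length J. \<Sum>k<num_phases J i. ?Z i k t) \<partial>lborel)"
    using Z_meas Z0 by (subst nn_integral_double_sum[symmetric]) (auto simp: ennreal_double_sum)
  also have "\<dots> \<le> (\<integral>\<^sup>+t. ennreal (1/2) * ennreal (real (num_active P J S t))
      + ennreal (energy_coeff \<alpha>) * ennreal (\<Sum>p<P. speed T t p powr \<alpha>) \<partial>lborel)"
  proof (intro nn_integral_mono)
    fix t
    have "ennreal (\<Sum>i<length J. \<Sum>k<num_phases J i. ?Z i k t)
      \<le> ennreal (1/2 * real (num_active P J S t) + energy_coeff \<alpha> * (\<Sum>p<P. speed T t p powr \<alpha>))"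
      using opt_progress_le[of t] by (intro ennreal_leI) simp
    also have "\<dots> = ennreal (1/2 * real (num_active P J S t)) + ennreal (energy_coeff \<alpha> * (\<Sum>p<P. speed T t p powr \<alpha>))"
      using energy_coeff_nonneg by (intro ennreal_plus) (auto intro!: mult_nonneg_nonneg sum_nonneg)
    also have "\<dots> = ennreal (1/2) * ennreal (real (num_active P J S t))
      + ennreal (energy_coeff \<alpha>) * ennreal (\<Sum>p<P. speed T t p powr \<alpha>)"
      using energy_coeff_nonneg by (subst (1 2) ennreal_mult) (auto intro!: sum_nonneg)
    finally show "ennreal (\<Sum>i<length J. \<Sum>k<num_phases J i. ?Z i k t)
      \<le> ennreal (1/2) * ennreal (real (num_active P J S t))
      + ennreal (energy_coeff \<alpha>) * ennreal (\<Sum>p<P. speed T t p powr \<alpha>)" .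
  qed
  also have "\<dots> = ennreal (1/2) * flow_time P J S + ennreal (energy_coeff \<alpha>) * energy \<alpha> P T"
    unfolding A.flow_time_eq O.energy_eq by (simp add: nn_integral_add nn_integral_cmult)
  finally show ?thesis by (simp add: add_mono mult_left_mono)
qed

end

section \<open>Existence\<close>

text \<open>With at most P jobs, every share is at least one processor before and after rounding, so
  rates are at least \<kappa> and all simulated phases end at finite times.\<close>

locale uceq_instance =
  fixes \<alpha> :: real and P :: nat and J :: "job list"
  assumes alpha: "1 < \<alpha>" and jobs: "job_set J" and len: "length J \<le> P" and P: "1 \<le> P"
begin

abbreviation n :: nat where "n \<equiv> length J"

definition rate :: "ereal \<Rightarrow> nat \<Rightarrow> real" where
  "rate h m = rate_const \<alpha> * real (whole h (real P / real m)) powr (1 - 1/\<alpha>)"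

text \<open>Completion times feed back into the allocation only through the number of active jobs, so a
  run is determined by a guess \<open>N\<close> for this number as a function of time.\<close>

primrec sim :: "(real \<Rightarrow> nat) \<Rightarrow> nat \<Rightarrow> nat \<Rightarrow> real" where
  "sim N i 0 = release (J ! i)"
| "sim N i (Suc k) = real_of_ereal (hit_time (ereal (sim N i k)) (work J i k) (\<lambda>x. rate (par J i k) (N x)))"

declare sim.simps(2) [simp del]

abbreviation fin :: "(real \<Rightarrow> nat) \<Rightarrow> nat \<Rightarrow> real" where
  "fin N i \<equiv> sim N i (num_phases J i)"

definition admissible :: "(real \<Rightarrow> nat) \<Rightarrow> bool" where
  "admissible N \<longleftrightarrow> N \<in> measurable borel (count_space UNIV) \<and> (\<forall>t. 1 \<le> N t \<and> N t \<le> P)"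

lemma rate_const_pos: "0 < rate_const \<alpha>"
  using alpha by (simp add: rate_const_def)

lemma rate_ge:
  assumes "1 \<le> h" "1 \<le> m" "m \<le> P"
  shows "rate_const \<alpha> \<le> rate h m"
proof -
  have "0 \<le> h" using assms(1) by (rule order_trans[rotated]) simp
  hence "1 \<le> whole h (real P / real m)"
    using assms by (subst le_whole_iff) (auto simp: le_divide_eq one_ereal_def)
  hence "1 \<le> real (whole h (real P / real m)) powr (1 - 1/\<alpha>)"
    using alpha by (intro ge_one_powr_ge_zero) auto
  thus ?thesis unfolding rate_def using rate_const_pos by simp
qed

lemma rate_le:
  assumes "0 \<le> h" "1 \<le> m"
  shows "rate h m \<le> rate_const \<alpha> * real P powr (1 - 1/\<alpha>)"
proof -
  have "real (whole h (real P / real m)) \<le> real P / real m" using assms by (intro whole_le) auto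
  also have "\<dots> \<le> real P / 1" using assms by (intro divide_left_mono) auto
  finally show ?thesis unfolding rate_def using rate_const_pos alpha
    by (intro mult_left_mono powr_mono2) auto
qed

lemma rate_measurable:
  assumes "admissible N"
  shows "(\<lambda>x. rate h (N x)) \<in> borel_measurable borel"
proof -
  have "N \<in> measurable borel (count_space UNIV)" using assms by (simp add: admissible_def)
  thus ?thesis by measurable
qed

lemma rate_locally_integrable:
  assumes N: "admissible N" and h: "0 \<le> h"
  shows "(\<integral>\<^sup>+x\<in>{a..b}. ennreal (rate h (N x)) \<partial>lborel) < \<infinity>"
proof -
  have "(\<integral>\<^sup>+x\<in>{a..b}. ennreal (rate h (N x)) \<partial>lborel)
    \<le> (\<integral>\<^sup>+x. ennreal (rate_const \<alpha> * real P powr (1 - 1/\<alpha>)) * indicator {a..b} x \<partial>lborel)"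
    using N rate_le[OF h] by (intro nn_integral_mono mult_right_mono ennreal_leI) (auto simp: admissible_def)
  also have "\<dots> < \<infinity>"
    by (simp add: nn_integral_cmult_indicator ennreal_mult_less_top emeasure_lborel_Icc_eq)
  finally show ?thesis .
qed

lemma hit_time_sim:
  assumes N: "admissible N" and i: "i < n" and k: "k < num_phases J i"
  shows "hit_time (ereal (sim N i k)) (work J i k) (\<lambda>x. rate (par J i k) (N x)) = ereal (sim N i (Suc k))"
proof -
  let ?h = "hit_time (ereal (sim N i k)) (work J i k) (\<lambda>x. rate (par J i k) (N x))"
  let ?b = "sim N i k + work J i k / rate_const \<alpha>"
  have w: "0 < work J i k" by (rule job_setD(3)[OF jobs i k])
  have "?h \<le> ereal ?b"
  proof (rule hit_time_le)
    show "sim N i k \<le> ?b" using w rate_const_pos by simp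
    have "ennreal (work J i k) = ennreal (rate_const \<alpha>) * ennreal (work J i k / rate_const \<alpha>)"
      using w rate_const_pos by (simp flip: ennreal_mult)
    also have "\<dots> = (\<integral>\<^sup>+x. ennreal (rate_const \<alpha>) * indicator {sim N i k..?b} x \<partial>lborel)"
      using w rate_const_pos by (simp add: nn_integral_cmult_indicator)
    also have "\<dots> \<le> (\<integral>\<^sup>+x\<in>{sim N i k..?b}. ennreal (rate (par J i k) (N x)) \<partial>lborel)"
      using N rate_ge[OF job_setD(4)[OF jobs i k]]
      by (intro nn_integral_mono mult_right_mono ennreal_leI) (auto simp: admissible_def)
    finally show "ennreal (work J i k) \<le> (\<integral>\<^sup>+x\<in>{sim N i k..?b}. ennreal (rate (par J i k) (N x)) \<partial>lborel)" .
  qed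
  moreover have "ereal (sim N i k) \<le> ?h" by (rule hit_time_ge)
  ultimately show ?thesis unfolding sim.simps(2) by (cases ?h) auto
qed

lemmas par_nonneg = job_set_par_nonneg[OF jobs]

lemma sim_mono:
  assumes "admissible N" "i < n" "k \<le> l" "l \<le> num_phases J i"
  shows "sim N i k \<le> sim N i l"
  using assms(3,4)
proof (induction l rule: dec_induct)
  case (step l)
  have "ereal (sim N i l) \<le> ereal (sim N i (Suc l))"
    using hit_time_ge[of "ereal (sim N i l)"] hit_time_sim[OF assms(1,2), of l] step by (metis Suc_le_lessD)
  thus ?case using step by simp
qed simp

text \<open>Causality: phase ends up to \<open>T\<close> depend on the guess before \<open>T\<close>
  only, since each is a hitting time determined by the rates before it.\<close>

lemma sim_local:
  assumes N: "admissible N" "admissible N'" and eq: "\<And>t. t < T \<Longrightarrow> N t = N' t"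
    and i: "i < n" and k: "k \<le> num_phases J i" and le: "sim N i k \<le> T"
  shows "sim N' i k = sim N i k"
  using k le
proof (induction k)
  case (Suc k)
  have kn: "k < num_phases J i" using Suc by simp
  have le: "sim N i k \<le> sim N i (Suc k)" by (rule sim_mono[OF N(1) i]) (use kn in auto)
  have IH: "sim N' i k = sim N i k" using Suc le by (intro Suc.IH) auto
  have "hit_time (ereal (sim N i k)) (work J i k) (\<lambda>x. rate (par J i k) (N' x)) = ereal (sim N i (Suc k))"
  proof (rule hit_time_cong_AE[OF rate_measurable[OF N(1)] rate_measurable[OF N(2)]
        rate_locally_integrable[OF N(1) par_nonneg[OF i kn]] hit_time_sim[OF N(1) i kn]])
    show "AE x in lborel. sim N i k \<le> x \<longrightarrow> x < sim N i (Suc k) \<longrightarrow> rate (par J i k) (N x) = rate (par J i k) (N' x)"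
      using eq Suc.prems(2) by (intro AE_I2 impI arg_cong[where f = "rate (par J i k)"]) auto
  qed
  thus ?case using hit_time_sim[OF N(2) i kn] IH by simp
qed simp

text \<open>A partially determined guess: jobs in \<open>D\<close> leave at their fixed times
  \<open>c\<close>, all others stay forever once released. The maximum with 1 keeps the quotient P /
  count meaningful while no job is present.\<close>

definition count :: "nat set \<Rightarrow> (nat \<Rightarrow> real) \<Rightarrow> real \<Rightarrow> nat" where
  "count D c t = max 1 (card {i. i < n \<and> release (J ! i) \<le> t \<and> (i \<in> D \<longrightarrow> t < c i)})"

lemma admissible_count: "admissible (count D c)"
proof -
  have "count D c = (\<lambda>t. max 1 (\<Sum>i<n. if release (J ! i) \<le> t \<and> (i \<in> D \<longrightarrow> t < c i) then 1 else 0))"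
    by (auto simp: count_def sum.If_cases Int_def fun_eq_iff)
  moreover have "(\<lambda>t. max 1 (\<Sum>i<n. if release (J ! i) \<le> t \<and> (i \<in> D \<longrightarrow> t < c i) then 1 else 0))
      \<in> measurable borel (count_space (UNIV :: nat set))"
    by measurable
  moreover have "count D c t \<le> P" for t
  proof -
    have "card {i. i < n \<and> release (J ! i) \<le> t \<and> (i \<in> D \<longrightarrow> t < c i)} \<le> card {..<n}"
      by (intro card_mono) auto
    thus ?thesis using len P by (simp add: count_def)
  qed
  ultimately show ?thesis by (auto simp: admissible_def count_def)
qed

text \<open>Jobs are fixed one at a time in the order of their completion: the next job to complete is
  not affected by the completions of the others.\<close>

lemma completions_exist:
  "m \<le> n \<Longrightarrow> \<exists>D c. D \<subseteq> {..<n} \<and> card D = m \<and> (\<forall>i\<in>D. fin (count D c) i = c i) \<and>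
     (\<forall>i\<in>D. \<forall>j<n. j \<notin> D \<longrightarrow> c i \<le> fin (count D c) j)"
proof (induction m)
  case 0
  show ?case by (intro exI[of _ "{}"]) auto
next
  case (Suc m)
  then obtain D c where D: "D \<subseteq> {..<n}" "card D = m"
    and fixed: "\<forall>i\<in>D. fin (count D c) i = c i"
    and later: "\<forall>i\<in>D. \<forall>j<n. j \<notin> D \<longrightarrow> c i \<le> fin (count D c) j" by (metis Suc_leD)
  define R where "R = {..<n} - D"
  \<comment> \<open>The earliest completion among the undetermined jobs. Fixing it changes the count
    only from \<open>T\<close> onwards, so by causality all completions up to \<open>T\<close>
    persist.\<close>
  define T where "T = Min (fin (count D c) ` R)"
  have "finite D" using D(1) by (rule finite_subset) simp
  have "R \<noteq> {}"
  proof
    assume "R = {}"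
    hence "{..<n} \<subseteq> D" by (auto simp: R_def)
    hence "card {..<n} \<le> card D" using \<open>finite D\<close> by (rule card_mono[rotated])
    thus False using D(2) Suc.prems by simp
  qed
  hence "T \<in> fin (count D c) ` R" unfolding T_def by (intro Min_in) (auto simp: R_def)
  then obtain j where j: "j \<in> R" "fin (count D c) j = T" by auto
  have T_le: "T \<le> fin (count D c) i" if "i \<in> R" for i
    unfolding T_def using that by (intro Min_le) (auto simp: R_def)
  have c_le: "c i \<le> T" if "i \<in> D" for i using later that j by (auto simp: R_def)
  define D' where "D' = insert j D"
  define c' where "c' = c(j := T)"
  have jD: "j \<notin> D" "j < n" using j by (auto simp: R_def)
  have same: "count D c t = count D' c' t" if "t < T" for t
    unfolding count_def using that jD
    by (intro arg_cong[where f = "max 1"] arg_cong[where f = card]) (auto simp: D'_def c'_def)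
  have keep: "fin (count D' c') i = fin (count D c) i" if "i < n" "fin (count D c) i \<le> T" for i
    using that same by (intro sim_local[where T = T] admissible_count) auto
  \<comment> \<open>Causality in the other direction: a completion before \<open>T\<close> under the
    new count would be one under the old count as well.\<close>
  have late: "T \<le> fin (count D' c') i" if i: "i < n" "T \<le> fin (count D c) i" for i
  proof (rule ccontr)
    assume "\<not> T \<le> fin (count D' c') i"
    hence "fin (count D c) i = fin (count D' c') i"
      using i same by (intro sim_local[where T = T] admissible_count) auto
    thus False using i \<open>\<not> T \<le> fin (count D' c') i\<close> by simp
  qed
  have "D' \<subseteq> {..<n}" "card D' = Suc m" using D jD \<open>finite D\<close> by (auto simp: D'_def)
  moreover have "fin (count D' c') i = c' i" if "i \<in> D'" for i
  proof (cases "i = j")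
    case True
    thus ?thesis using keep[of j] j jD by (simp add: c'_def)
  next
    case False
    hence "i \<in> D" using that by (simp add: D'_def)
    thus ?thesis using keep[of i] fixed c_le[of i] D(1) False by (auto simp: c'_def)
  qed
  moreover have "c' i \<le> fin (count D' c') l" if "i \<in> D'" "l < n" "l \<notin> D'" for i l
  proof -
    have "c' i \<le> T" using that c_le by (auto simp: D'_def c'_def)
    also have "T \<le> fin (count D' c') l"
      using that T_le[of l] by (intro late) (auto simp: R_def D'_def)
    finally show ?thesis .
  qed
  ultimately show ?case by blast
qed

lemma consistent_count:
  "\<exists>N. admissible N \<and> (\<forall>t. N t = max 1 (card {i. i < n \<and> release (J ! i) \<le> t \<and> t < fin N i}))"
proof -
  obtain D c where D: "D \<subseteq> {..<n}" "card D = n" and c: "\<And>i. i \<in> D \<Longrightarrow> fin (count D c) i = c i"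
    using completions_exist[of n] by auto
  have "D = {..<n}" using D by (intro card_subset_eq) auto
  hence "count D c t = max 1 (card {i. i < n \<and> release (J ! i) \<le> t \<and> t < fin (count D c) i})" for t
    using c unfolding count_def[of D c t]
    by (intro arg_cong[where f = "max 1"] arg_cong[where f = card]) auto
  thus ?thesis using admissible_count by blast
qed

end

section \<open>A consistent count realized as a schedule\<close>

locale consistent_run = uceq_instance +
  fixes N :: "real \<Rightarrow> nat"
  assumes adm: "admissible N"
    and N_eq: "\<And>t. N t = max 1 (card {i. i < n \<and> release (J ! i) \<le> t \<and> t < fin N i})"
begin

abbreviation E :: "nat \<Rightarrow> nat \<Rightarrow> real" where "E \<equiv> sim N"

abbreviation c :: "nat \<Rightarrow> real" where "c \<equiv> fin N"

text \<open>Closed at the completion times like \<open>num_active\<close>, whereas \<open>N\<close>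
  is half-open. The rule of U-CEQ must hold at every instant, hence with \<open>num\<close>; for the
  phase ends, agreement almost everywhere suffices.\<close>

definition num :: "real \<Rightarrow> nat" where
  "num t = card {i. i < n \<and> release (J ! i) \<le> t \<and> t \<le> c i}"

text \<open>A sum with at most one nonzero term instead of a choice of the current phase, which
  makes measurability immediate.\<close>

definition share :: "nat \<Rightarrow> real \<Rightarrow> nat" where
  "share i t = (\<Sum>k<num_phases J i. if E i k \<le> t \<and> t < E i (Suc k)
     then whole (par J i k) (real P / real (num t)) else 0)"

definition start :: "nat \<Rightarrow> real \<Rightarrow> nat" where
  "start i t = (\<Sum>j<i. share j t)"

text \<open>Job \<open>i\<close> receives the block of processors from \<open>start i t\<close> up
  to but excluding \<open>start (Suc i) t\<close>; consecutive blocks are disjoint and cover those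
  below \<open>start n t\<close>.\<close>

definition run :: schedule where
  "run = \<lparr>owner = (\<lambda>t p. if p < start n t then Some (LEAST i. p < start (Suc i) t) else None),
     speed = (\<lambda>t p. \<Sum>i<n. if start i t \<le> p \<and> p < start (Suc i) t
       then (1 / ((\<alpha> - 1) * real (share i t))) powr (1 / \<alpha>) else 0)\<rparr>"

lemma E_mono: "i < n \<Longrightarrow> k \<le> l \<Longrightarrow> l \<le> num_phases J i \<Longrightarrow> E i k \<le> E i l"
  by (rule sim_mono[OF adm])

lemma share_in_phase:
  assumes i: "i < n" and k: "k < num_phases J i" "E i k \<le> t" "t < E i (Suc k)"
  shows "share i t = whole (par J i k) (real P / real (num t))"
proof -
  have uniq: "l = k" if "l < num_phases J i" "E i l \<le> t" "t < E i (Suc l)" for l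
  proof (rule ccontr)
    assume "l \<noteq> k"
    then consider "Suc k \<le> l" | "Suc l \<le> k" by linarith
    thus False using that k E_mono[OF i, of "Suc k" l] E_mono[OF i, of "Suc l" k]
      by cases auto
  qed
  have "share i t = (\<Sum>l<num_phases J i. if l = k then whole (par J i k) (real P / real (num t)) else 0)"
    unfolding share_def
  proof (intro sum.cong refl)
    fix l assume "l \<in> {..<num_phases J i}"
    hence "E i l \<le> t \<and> t < E i (Suc l) \<longleftrightarrow> l = k" using uniq[of l] k by blast
    thus "(if E i l \<le> t \<and> t < E i (Suc l) then whole (par J i l) (real P / real (num t)) else 0)
      = (if l = k then whole (par J i k) (real P / real (num t)) else 0)"
      by simp
  qed
  thus ?thesis using k by simp
qed

lemma share_not_in_phase:
  assumes "\<And>k. k < num_phases J i \<Longrightarrow> E i k \<le> t \<Longrightarrow> \<not> t < E i (Suc k)"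
  shows "share i t = 0"
  unfolding share_def using assms by (intro sum.neutral) auto

lemma share_pos_active:
  assumes "i < n" "share i t \<noteq> 0"
  shows "release (J ! i) \<le> t" "t \<le> c i"
proof -
  obtain k where k: "k < num_phases J i" "E i k \<le> t" "t < E i (Suc k)"
    using share_not_in_phase[of i t] assms(2) by blast
  show "release (J ! i) \<le> t" "t \<le> c i"
    using k E_mono[OF assms(1), of 0 k] E_mono[OF assms(1), of "Suc k" "num_phases J i"]
    by auto
qed

lemma share_le: "i < n \<Longrightarrow> real (share i t) \<le> real P / real (num t)"
proof (cases "share i t = 0")
  case False
  assume i: "i < n"
  obtain k where k: "k < num_phases J i" "E i k \<le> t" "t < E i (Suc k)"
    using share_not_in_phase[of i t] False by blast
  show ?thesis unfolding share_in_phase[OF i k] using par_nonneg[OF i k(1)] by (intro whole_le) auto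
qed simp

text \<open>Only the \<open>num t\<close> counted jobs have a positive share, and each share is at
  most P / \<open>num t\<close>.\<close>

lemma start_le: "start n t \<le> P"
proof -
  let ?A = "{i. i < n \<and> release (J ! i) \<le> t \<and> t \<le> c i}"
  have "real (start n t) = (\<Sum>i<n. real (share i t))" by (simp add: start_def)
  also have "\<dots> = (\<Sum>i\<in>?A. real (share i t))"
    using share_pos_active by (intro sum.mono_neutral_right) force+
  also have "\<dots> \<le> real (card ?A) * (real P / real (num t))"
    using share_le by (intro sum_bounded_above) auto
  also have "\<dots> \<le> real P" by (simp add: num_def)
  finally show ?thesis by simp
qed

lemma start_mono: "i \<le> j \<Longrightarrow> start i t \<le> start j t"
  unfolding start_def by (intro sum_mono2) auto

lemma owner_run: "owner run t p = Some i \<longleftrightarrow> i < n \<and> start i t \<le> p \<and> p < start (Suc i) t"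
proof
  assume "owner run t p = Some i"
  hence p: "p < start n t" and i: "i = (LEAST i. p < start (Suc i) t)"
    by (auto simp: run_def split: if_splits)
  have "n \<noteq> 0" using p by (auto simp: start_def intro: ccontr)
  then obtain m where m: "n = Suc m" using not0_implies_Suc by blast
  have "i \<le> m" unfolding i using p m by (intro Least_le) auto
  moreover have "p < start (Suc i) t" unfolding i by (rule LeastI[of _ m]) (use p m in simp)
  moreover have "start i t \<le> p"
  proof (cases i)
    case (Suc l)
    hence "\<not> p < start (Suc l) t" using not_less_Least[of l "\<lambda>i. p < start (Suc i) t"] i by simp
    thus ?thesis using Suc by simp
  qed (simp add: start_def)
  ultimately show "i < n \<and> start i t \<le> p \<and> p < start (Suc i) t" using m by simp
next
  assume i: "i < n \<and> start i t \<le> p \<and> p < start (Suc i) t"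
  have "(LEAST i. p < start (Suc i) t) = i"
  proof (rule Least_equality)
    fix j assume j: "p < start (Suc j) t"
    show "i \<le> j"
    proof (rule ccontr)
      assume "\<not> i \<le> j"
      hence "start (Suc j) t \<le> start i t" by (intro start_mono) simp
      thus False using i j by simp
    qed
  qed (use i in simp)
  moreover have "p < start n t" using i start_mono[of "Suc i" n t] by simp
  ultimately show "owner run t p = Some i" by (simp add: run_def)
qed

lemma speed_run:
  assumes "owner run t p = Some i"
  shows "speed run t p = (1 / ((\<alpha> - 1) * real (share i t))) powr (1 / \<alpha>)"
proof -
  let ?s = "\<lambda>j. if start j t \<le> p \<and> p < start (Suc j) t
       then (1 / ((\<alpha> - 1) * real (share j t))) powr (1 / \<alpha>) else 0"
  have i: "i < n" "start i t \<le> p" "p < start (Suc i) t" using assms by (auto simp: owner_run)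
  have "(\<Sum>j<n. ?s j) = (\<Sum>j<n. if j = i then ?s i else 0)"
  proof (intro sum.cong refl)
    fix j assume "j \<in> {..<n}"
    thus "?s j = (if j = i then ?s i else 0)"
      using assms owner_run[of t p j] by (cases "j = i") auto
  qed
  thus ?thesis using i by (simp add: run_def)
qed

lemma speed_run_None:
  assumes "owner run t p = None"
  shows "speed run t p = 0"
proof -
  have "\<not> (start j t \<le> p \<and> p < start (Suc j) t)" if "j < n" for j
    using assms owner_run[of t p j] that by simp
  thus ?thesis unfolding run_def schedule.simps by (intro sum.neutral) auto
qed

lemma alloc_run:
  assumes "i < n"
  shows "alloc P run i t = share i t"
proof -
  have "start (Suc i) t \<le> P" using start_mono[of "Suc i" n t] start_le[of t] assms by simp
  hence "{p. p < P \<and> owner run t p = Some i} = {start i t..<start (Suc i) t}"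
    using assms by (auto simp: owner_run)
  thus ?thesis by (simp add: alloc_def start_def)
qed

lemma num_measurable [measurable]: "num \<in> measurable borel (count_space UNIV)"
proof -
  have "num = (\<lambda>t. \<Sum>i<n. if release (J ! i) \<le> t \<and> t \<le> c i then 1 else 0)"
    by (auto simp: num_def sum.If_cases Int_def fun_eq_iff)
  thus ?thesis by simp
qed

lemma share_measurable [measurable]: "share i \<in> measurable borel (count_space UNIV)"
proof -
  have [measurable]: "(\<lambda>t. whole h (real P / real (num t))) \<in> measurable borel (count_space UNIV)" for h
    by (rule measurable_compose[OF num_measurable]) simp
  show ?thesis unfolding share_def [abs_def] by measurable
qed

lemma start_measurable [measurable]: "start i \<in> measurable borel (count_space UNIV)"
  unfolding start_def [abs_def] by measurable

lemma owner_run_sets: "{t. owner run t p = Some i} \<in> sets borel"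
  unfolding owner_run by measurable

lemma speed_run_measurable: "(\<lambda>t. speed run t p) \<in> borel_measurable borel"
  unfolding run_def schedule.simps by measurable

lemma speed_run_nonneg: "0 \<le> speed run t p"
  by (auto simp: run_def intro!: sum_nonneg)

lemma exec_rate_run:
  assumes i: "i < n" and k: "k < num_phases J i" "E i k \<le> t" "t < E i (Suc k)"
  shows "exec_rate P run i (par J i k) t = rate (par J i k) (num t)"
proof -
  have "exec_rate P run i (par J i k) t
      = real (alloc P run i t) * (1 / ((\<alpha> - 1) * real (alloc P run i t))) powr (1 / \<alpha>)"
  proof (rule exec_rate_const_speed)
    show "ereal (real (alloc P run i t)) \<le> par J i k"
      unfolding alloc_run[OF i] share_in_phase[OF assms]
      using par_nonneg[OF i k(1)] by (intro whole_le_parallelism) auto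
  qed (use par_nonneg[OF i k(1)] speed_run alloc_run[OF i] in auto)
  thus ?thesis
    unfolding uniform_rate_eq[OF alpha] rate_def alloc_run[OF i] share_in_phase[OF assms] .
qed

lemma AE_num: "AE t in lborel. \<forall>i<n. release (J ! i) \<le> t \<longrightarrow> t < c i \<longrightarrow> N t = num t"
proof -
  have "AE t in lborel. t \<notin> c ` {..<n}"
    by (intro AE_not_in finite_imp_null_set_lborel) auto
  thus ?thesis
  proof (rule AE_mp, intro AE_I2 impI allI)
    fix t i assume t: "t \<notin> c ` {..<n}" and i: "i < n" "release (J ! i) \<le> t" "t < c i"
    let ?A = "{i. i < n \<and> release (J ! i) \<le> t \<and> t < c i}"
    have "?A = {i. i < n \<and> release (J ! i) \<le> t \<and> t \<le> c i}"
      using t by (auto simp: order.order_iff_strict)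
    moreover have "0 < card ?A" using i by (auto simp: card_gt_0_iff)
    ultimately show "N t = num t" unfolding N_eq[of t] num_def by simp
  qed
qed

text \<open>By induction a phase starts at its simulated time, and during its simulated window the
  rates obtained from \<open>num\<close> and from \<open>N\<close> differ at most on a null set,
  which leaves the hitting time unchanged.\<close>

lemma phase_end_run:
  assumes i: "i < n" and "k \<le> num_phases J i"
  shows "phase_end P J run i k = ereal (E i k)"
  using assms(2)
proof (induction k)
  case (Suc k)
  hence k: "k < num_phases J i" and IH: "phase_end P J run i k = ereal (E i k)" by auto
  have "speed_for run i p \<in> borel_measurable borel" for p
    unfolding speed_for_def [abs_def]
    by (intro borel_measurable_times borel_measurable_indicator speed_run_measurable owner_run_sets)
  hence meas: "exec_rate P run i (par J i k) \<in> borel_measurable borel"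
    by (intro borel_measurable_exec_rate par_nonneg[OF i k] speed_run_nonneg)
  have "hit_time (ereal (E i k)) (work J i k) (exec_rate P run i (par J i k)) = ereal (E i (Suc k))"
  proof (rule hit_time_cong_AE[OF rate_measurable[OF adm] meas
        rate_locally_integrable[OF adm par_nonneg[OF i k]] hit_time_sim[OF adm i k]])
    show "AE x in lborel. E i k \<le> x \<longrightarrow> x < E i (Suc k) \<longrightarrow> rate (par J i k) (N x) = exec_rate P run i (par J i k) x"
    proof (rule AE_mp[OF AE_num], intro AE_I2 impI)
      fix x assume N: "\<forall>i<n. release (J ! i) \<le> x \<longrightarrow> x < c i \<longrightarrow> N x = num x"
        and x: "E i k \<le> x" "x < E i (Suc k)"
      have "release (J ! i) \<le> x" "x < c i"
        using x k E_mono[OF i, of 0 k] E_mono[OF i, of "Suc k" "num_phases J i"]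
        by auto
      thus "rate (par J i k) (N x) = exec_rate P run i (par J i k) x"
        using exec_rate_run[OF i k x] N i by simp
    qed
  qed
  thus ?case unfolding phase_end_Suc IH .
qed simp

lemma num_active_run: "num_active P J run t = num t"
  unfolding num_active_def num_def active_def completion_def
  by (intro arg_cong[where f = card]) (auto simp: phase_end_run)

lemma in_phase_run:
  "i < n \<Longrightarrow> in_phase P J run i k t \<longleftrightarrow> k < num_phases J i \<and> E i k \<le> t \<and> t < E i (Suc k)"
  unfolding in_phase_def by (cases "k < num_phases J i") (auto simp: phase_end_run simp del: phase_end.simps)

lemma uceq_run: "uceq_schedule \<alpha> P J run"
proof -
  have "valid_schedule P J run"
    unfolding valid_schedule_def
  proof (intro conjI allI impI)
    fix t p i assume "owner run t p = Some i"
    hence i: "i < n" "start i t < start (Suc i) t" by (auto simp: owner_run)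
    thus "i < length J" "release (J ! i) \<le> t"
      using share_pos_active(1)[of i t] by (auto simp: start_def)
  next
    fix i assume "i < length J"
    thus "completion P J run i < \<infinity>" by (simp add: completion_def phase_end_run)
  qed (auto simp: speed_run_measurable owner_run_sets speed_run_nonneg speed_run_None)
  moreover have "alloc P run i t = whole (par J i k) (real P / real (num_active P J run t))"
    if "i < n" "in_phase P J run i k t" for i k t
    using that by (simp add: in_phase_run alloc_run share_in_phase num_active_run)
  moreover have "alloc P run i t = 0" if "i < n" "\<nexists>k. in_phase P J run i k t" for i t
    using that by (auto simp: in_phase_run alloc_run intro!: share_not_in_phase)
  ultimately show ?thesis
    unfolding uceq_schedule_def whole_def using speed_run by (auto simp: alloc_run)
qed

end

lemma uceq_schedule_exists:
  assumes "1 < \<alpha>" "job_set J" "length J \<le> P" "1 \<le> P"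
  shows "\<exists>S. uceq_schedule \<alpha> P J S"
proof -
  interpret uceq_instance \<alpha> P J using assms by unfold_locales
  obtain N where N: "admissible N"
      "\<forall>t. N t = max 1 (card {i. i < n \<and> release (J ! i) \<le> t \<and> t < fin N i})"
    using consistent_count by blast
  interpret consistent_run \<alpha> P J N by unfold_locales (use N in blast)+
  show ?thesis using uceq_run by blast
qed

section \<open>Competitive ratio\<close>

text \<open>The first factor passes from flow time to flow time plus energy, and the 2 comes from
  absorbing half of the flow time. The three summands stem from jobs active in the other schedule,
  limited phases and lagging phases.\<close>

definition competitive_ratio :: "real \<Rightarrow> real" where
  "competitive_ratio \<alpha> = (1 + 1 / (\<alpha> - 1)) * (2 * (2 + 2 / rate_const \<alpha> + energy_coeff \<alpha>))"

lemma competitive_ratio_pos: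
  assumes "1 < \<alpha>"
  shows "0 < competitive_ratio \<alpha>"
proof -
  have "0 < rate_const \<alpha>" using assms by (simp add: rate_const_def)
  thus ?thesis using assms unfolding competitive_ratio_def energy_coeff_def
    by (intro mult_pos_pos add_pos_nonneg) auto
qed

lemma uceq_cost_le:
  assumes "1 < \<alpha>" "job_set J" "1 \<le> P" "uceq_schedule \<alpha> P J S" "valid_schedule P J T"
  shows "cost \<alpha> P J S \<le> ennreal (competitive_ratio \<alpha>) * cost \<alpha> P J T"
proof (cases "energy \<alpha> P T < \<infinity>")
  case False
  have "0 < competitive_ratio \<alpha>" by (rule competitive_ratio_pos[OF assms(1)])
  moreover have "energy \<alpha> P T = \<infinity>" using False by (simp add: less_top[symmetric])
  hence "cost \<alpha> P J T = \<infinity>" by (simp add: cost_def)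
  ultimately show ?thesis by (simp add: ennreal_mult_top)
next
  case True
  interpret A: uceq \<alpha> P J S
    using assms by unfold_locales (auto simp: uceq_schedule_def)
  interpret competition \<alpha> P J S T
    using assms True by unfold_locales auto
  \<comment> \<open>All quantities are finite here, so the estimate moves to the reals, where f / 2
    can be subtracted from both sides.\<close>
  obtain f where f: "flow_time P J S = ennreal f" "0 \<le> f"
    using A.flow_time_finite by (cases "flow_time P J S" rule: ennreal_cases) auto
  obtain f' where f': "flow_time P J T = ennreal f'" "0 \<le> f'"
    using O.flow_time_finite by (cases "flow_time P J T" rule: ennreal_cases) auto
  obtain e' where e': "energy \<alpha> P T = ennreal e'" "0 \<le> e'"
    using True by (cases "energy \<alpha> P T" rule: ennreal_cases) auto
  have k: "0 < A.\<kappa>" "0 \<le> energy_coeff \<alpha>" by (rule A.kappa_pos energy_coeff_nonneg)+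
  define K where "K = 2 + 2 / A.\<kappa> + energy_coeff \<alpha>"
  have "ennreal f \<le> 2 * ennreal f' + ennreal (2 / A.\<kappa>) * (ennreal f' + ennreal e')
      + (ennreal (1/2) * ennreal f + ennreal (energy_coeff \<alpha>) * ennreal e')"
    using flow_time_le by (simp only: f f' e')
  also have "\<dots> = ennreal (2 * f' + 2 / A.\<kappa> * (f' + e') + (1/2 * f + energy_coeff \<alpha> * e'))"
    using f(2) f'(2) e'(2) k
    by (simp add: ennreal_mult[of 2] ennreal_mult[of "2 / A.\<kappa>"] ennreal_mult[of "1/2"]
        ennreal_mult[of "energy_coeff \<alpha>"] del: times_divide_eq_left)
  finally have "f \<le> 2 * f' + 2 / A.\<kappa> * (f' + e') + (1/2 * f + energy_coeff \<alpha> * e')"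
    using f(2) f'(2) e'(2) k by (subst (asm) ennreal_le_iff) auto
  moreover have "2 * f' + 2 / A.\<kappa> * (f' + e') + energy_coeff \<alpha> * e' \<le> K * (f' + e')"
    using f'(2) e'(2) k by (simp add: K_def algebra_simps)
  ultimately have le: "f \<le> 2 * K * (f' + e')" by simp
  have "cost \<alpha> P J S \<le> ennreal f + ennreal (1 / (\<alpha> - 1)) * ennreal f"
    unfolding cost_def f(1)[symmetric] using A.energy_le by (rule add_left_mono)
  also have "\<dots> = ennreal ((1 + 1 / (\<alpha> - 1)) * f)"
    unfolding distrib_right using assms(1) f(2) by (subst ennreal_plus) (auto simp flip: ennreal_mult)
  also have "\<dots> \<le> ennreal (competitive_ratio \<alpha> * (f' + e'))"
    unfolding competitive_ratio_def K_def[symmetric] mult.assoc using le assms(1)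
    by (intro ennreal_leI mult_left_mono) (auto simp: mult.assoc)
  also have "\<dots> = ennreal (competitive_ratio \<alpha>) * cost \<alpha> P J T"
    unfolding cost_def f'(1) e'(1) using f'(2) e'(2) competitive_ratio_pos[OF assms(1)]
    by (subst ennreal_mult) auto
  finally show ?thesis .
qed

theorem theorem7:
  fixes \<alpha> :: real
  assumes "1 < \<alpha>"
  shows "\<exists>C>0. \<forall>P\<ge>1. \<forall>J. job_set J \<longrightarrow>
    (length J \<le> P \<longrightarrow> (\<exists>S. uceq_schedule \<alpha> P J S)) \<and>
    (\<forall>S. uceq_schedule \<alpha> P J S \<longrightarrow> cost \<alpha> P J S \<le> ennreal C * opt_cost \<alpha> P J)"
proof (intro exI[of _ "competitive_ratio \<alpha>"] conjI allI impI)
  show "0 < competitive_ratio \<alpha>" by (rule competitive_ratio_pos[OF assms])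
next
  fix P :: nat and J :: "job list"
  assume "1 \<le> P" "job_set J" "length J \<le> P"
  thus "\<exists>S. uceq_schedule \<alpha> P J S" using assms by (intro uceq_schedule_exists)
next
  fix P :: nat and J :: "job list" and S
  assume PJ: "1 \<le> P" "job_set J" and S: "uceq_schedule \<alpha> P J S"
  have C: "0 < competitive_ratio \<alpha>" by (rule competitive_ratio_pos[OF assms])
  \<comment> \<open>Dividing first makes the left side a lower bound for the cost of every valid
    schedule, hence for the infimum; multiplying back is safe as the ratio is positive and
    finite.\<close>
  have "cost \<alpha> P J S / ennreal (competitive_ratio \<alpha>) \<le> opt_cost \<alpha> P J"
    unfolding opt_cost_def using uceq_cost_le[OF assms PJ(2,1) S] C
    by (intro INF_greatest divide_le_posI_ennreal) auto
  hence "cost \<alpha> P J S / ennreal (competitive_ratio \<alpha>) * ennreal (competitive_ratio \<alpha>)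
      \<le> opt_cost \<alpha> P J * ennreal (competitive_ratio \<alpha>)"
    by (rule mult_right_mono) simp
  moreover have "cost \<alpha> P J S / ennreal (competitive_ratio \<alpha>) * ennreal (competitive_ratio \<alpha>) = cost \<alpha> P J S"
    using C by (simp add: ennreal_divide_times)
  ultimately show "cost \<alpha> P J S \<le> ennreal (competitive_ratio \<alpha>) * opt_cost \<alpha> P J"
    by (simp add: mult.commute)
qed

end
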